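(* Let $I$ be an open interval, $X$ a Banach space, and $F:I\times X\to X$ a $C^2$-function. Suppose $W_m$ is an $F$-invariant subspace of $X$, $(s^*,x^* )\in I\times W_m$ satisfies $F(s^*,x^* )=0$, and $D_2F(s^*,x^* )|_{W_m}$ is nonsingular. Let $b_m:I_m\to W_m$ and $C_m=\{(s,b_m(s)) : s\in I_m\}$ be the mother branch function and the mother branch (defined in the context). Assume $W_m\subsetneq W_d\subseteq X$ are nested $F$-invariant subspaces, and let $F_d:I\times W_d\to W_d$ be the restriction of $F$. Assume $J:I_m\to L(W_d)$, $J(s):=D_2F_d(s,b_m(s))$, satisfies the following conditions: (a) $N(J(s^* ))$ is one-dimensional, and $R(J(s^* ))$ has codimension one. (b) $J'(s^* )(x_0)\notin R(J(s^* ))$, where $N(J(s^* ))=\operatorname{Span}(\{x_0\})$. If $Z$ is any complement of $\operatorname{Span}(\{x_0\})$ in $W_d$, then there is a neighborhood $U$ of $(s^*,x^* )$ in $I\times X$, an interval $(-a,a)$, and $C^1$-functions $\varphi:(-a,a)\to\mathbb{R}$ and $\psi:(-a,a)\to Z$ with $\varphi(0)=s^*$ and $\psi(0)=0$ such that $$F^{-1}(\{0\})\cap(I\times W_d)\cap U=C_m\cup C_d,$$ where $$C_d:=\{(\varphi(\alpha),\,b_m(\varphi(\alpha))+\alpha x_0+\alpha\psi(\alpha)) : |\alpha|<a\}$$ is the so-called daughter branch. Furthermore, $C_m\cap C_d=\{(s^*,x^* )\}$. That is, there are exactly two branches in $(I\times W_d)\cap U$ that contain $(s^*,x^* )$: the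 mother branch $C_m$ and the daughter branch $C_d$.
   Context: For $F:I\times X\to X$ with $I$ an open interval and $X$ a Banach space, a subspace $W$ of $X$ is $F$-invariant if $F(s,W)\subseteq W$ for all $s\in I$. $D_1$ and $D_2$ denote the partial derivatives with respect to the first variable ($s$) and the second variable ($x$). $L(W_d)$ is the space of bounded linear operators on $W_d$; $N(\cdot)$ and $R(\cdot)$ denote null space and range. Mother branch: under the hypotheses on $F$, $W_m$ and $(s^*,x^* )$ in the first two sentences of the claim, the Implicit Function Theorem applied to the restriction of $F$ to $I\times W_m$ gives a neighborhood $U_0$ of $(s^*,x^* )$ in $I\times X$ and a $C^2$-function $b_m:I_m\to W_m$, defined on an open interval $I_m$ containing $s^*$, such that $b_m(s^* )=x^*$ and $F^{-1}(\{0\})\cap(I\times W_m)\cap U_0=C_m$, where $C_m:=\{(s,b_m(s)) : s\in I_m\}$. The function $b_m$ is called the mother branch function and its graph $C_m$ the mother branch. (If $W_m=\{0\}$, then $D_2F(s^*,x^* )|_{W_m}$ is vacuously nonsingular.) A simple $C^1$-curve is the image of an injective $C^1$-function from an open interval to $I\times X$ with non-vanishing derivative. A solution branch of $F$, or simply a branch, is a simple $C^1$-curve that is a subset of $F^{-1}(\{0\})$.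
   Formalization: The subspace W_d and the complement Z are assumed closed (the claim fails for non-closed W_d or a merely algebraic complement Z); the neighborhood U need not be open, and "exactly two branches" is read up to containment of sub-arcs. *)

theory Defs
  imports "HOL-Analysis.Analysis"
begin

definition open_interval :: "real set \<Rightarrow> bool" where
  "open_interval T \<longleftrightarrow> open T \<and> is_interval T \<and> T \<noteq> {}"

definition C2_on :: "'a::real_normed_vector set \<Rightarrow> ('a \<Rightarrow> 'b::real_normed_vector) \<Rightarrow> bool" where
  "C2_on S f \<longleftrightarrow>
     (\<exists>(f' :: 'a \<Rightarrow> 'a \<Rightarrow>\<^sub>L 'b) (f'' :: 'a \<Rightarrow> 'a \<Rightarrow>\<^sub>L 'a \<Rightarrow>\<^sub>L 'b).
        (\<forall>x\<in>S. (f has_derivative blinfun_apply (f' x)) (at x)) \<and>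
        (\<forall>x\<in>S. (f' has_derivative blinfun_apply (f'' x)) (at x)) \<and>
        continuous_on S f'')"

text \<open>
  Neighborhoods are not required to be open. This matters where a zero set inside a neighborhood is
  equated with a set containing a whole mother branch: further branches may bifurcate from the
  mother branch away from the base point, and an open set containing the branch would meet them.
\<close>

definition neighborhood_in :: "'a::topological_space set \<Rightarrow> 'a \<Rightarrow> 'a set \<Rightarrow> bool" where
  "neighborhood_in Y p U \<longleftrightarrow>
     U \<subseteq> Y \<and> (\<exists>V. openin (top_of_set Y) V \<and> p \<in> V \<and> V \<subseteq> U)"

definition F_invariant :: "real set \<Rightarrow> (real \<times> 'a \<Rightarrow> 'a::real_vector) \<Rightarrow> 'a set \<Rightarrow> bool" where
  "F_invariant I F W \<longleftrightarrow> subspace W \<and> (\<forall>s\<in>I. \<forall>x\<in>W. F (s, x) \<in> W)"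

definition D2 :: "(real \<times> 'a \<Rightarrow> 'b) \<Rightarrow> real \<times> 'a \<Rightarrow> 'a::real_normed_vector \<Rightarrow>\<^sub>L 'b::real_normed_vector" where
  "D2 F p = Blinfun (frechet_derivative (\<lambda>x. F (fst p, x)) (at (snd p)))"

text \<open>
  For an \<open>F\<close>-invariant subspace \<open>W\<close>, an element of \<open>L(W)\<close> is represented by a bounded operator
  on the whole space that maps \<open>W\<close> into \<open>W\<close>; the following notions only look at its restriction
  to \<open>W\<close>.
\<close>

definition null_space_on :: "'a::real_normed_vector set \<Rightarrow> ('a \<Rightarrow>\<^sub>L 'a) \<Rightarrow> 'a set" where
  "null_space_on W T = {w \<in> W. blinfun_apply T w = 0}"

definition range_on :: "'a::real_normed_vector set \<Rightarrow> ('a \<Rightarrow>\<^sub>L 'a) \<Rightarrow> 'a set" where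
  "range_on W T = blinfun_apply T ` W"

text \<open>
  On a closed subspace of a Banach space, a bijective bounded operator has a bounded inverse.
\<close>

definition nonsingular_on :: "'a::real_normed_vector set \<Rightarrow> ('a \<Rightarrow>\<^sub>L 'a) \<Rightarrow> bool" where
  "nonsingular_on W T \<longleftrightarrow> bij_betw (blinfun_apply T) W W"

text \<open>\<open>complement_in V Z W\<close>: \<open>W\<close> is the (algebraic) direct sum of \<open>V\<close> and \<open>Z\<close>.\<close>

definition complement_in :: "'a::real_vector set \<Rightarrow> 'a set \<Rightarrow> 'a set \<Rightarrow> bool" where
  "complement_in V Z W \<longleftrightarrow>
     subspace V \<and> subspace Z \<and> V \<inter> Z = {0} \<and> {v + z | v z. v \<in> V \<and> z \<in> Z} = W"

definition codim_one_in :: "'a::real_vector set \<Rightarrow> 'a set \<Rightarrow> bool" where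
  "codim_one_in R W \<longleftrightarrow> (\<exists>C. complement_in R C W \<and> dim C = 1)"

definition mother_branch :: "real set \<Rightarrow> (real \<Rightarrow> 'a) \<Rightarrow> (real \<times> 'a) set" where
  "mother_branch I_m b = {(s, b s) | s. s \<in> I_m}"

definition mother_branch_function ::
    "real set \<Rightarrow> (real \<times> 'a \<Rightarrow> 'a) \<Rightarrow> 'a::real_normed_vector set \<Rightarrow> real \<Rightarrow> 'a \<Rightarrow>
     real set \<Rightarrow> (real \<Rightarrow> 'a) \<Rightarrow> bool" where
  "mother_branch_function I F W s x I_m b \<longleftrightarrow>
     open_interval I_m \<and> s \<in> I_m \<and> I_m \<subseteq> I \<and>
     b ` I_m \<subseteq> W \<and> C2_on I_m b \<and> b s = x \<and>
     (\<exists>U0. neighborhood_in (I \<times> UNIV) (s, x) U0 \<and>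
           {p. F p = 0} \<inter> (I \<times> W) \<inter> U0 = mother_branch I_m b)"

definition daughter_branch ::
    "(real \<Rightarrow> 'a) \<Rightarrow> 'a \<Rightarrow> real \<Rightarrow> (real \<Rightarrow> real) \<Rightarrow> (real \<Rightarrow> 'a) \<Rightarrow> (real \<times> 'a::real_vector) set" where
  "daughter_branch b v a \<phi> \<psi> =
     {(\<phi> \<alpha>, b (\<phi> \<alpha>) + \<alpha> *\<^sub>R v + \<alpha> *\<^sub>R \<psi> \<alpha>) | \<alpha>. \<bar>\<alpha>\<bar> < a}"

definition simple_C1_curve :: "'a::real_normed_vector set \<Rightarrow> bool" where
  "simple_C1_curve B \<longleftrightarrow>
     (\<exists>T \<gamma>. open_interval T \<and> \<gamma> C1_differentiable_on T \<and> inj_on \<gamma> T \<and>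
            (\<forall>t\<in>T. vector_derivative \<gamma> (at t) \<noteq> 0) \<and> B = \<gamma> ` T)"

definition solution_branch ::
    "real set \<Rightarrow> (real \<times> 'a \<Rightarrow> 'a) \<Rightarrow> (real \<times> 'a::real_normed_vector) set \<Rightarrow> bool" where
  "solution_branch I F B \<longleftrightarrow>
     simple_C1_curve B \<and> B \<subseteq> {p. F p = 0} \<inter> (I \<times> UNIV)"

text \<open>
  \<open>J b\<close> stands for the function \<open>s \<mapsto> D\<^sub>2 F\<^sub>d (s, b s)\<close> into \<open>L(W\<^sub>d)\<close>, for every invariant \<open>W\<^sub>d\<close> that
  contains the range of \<open>b\<close>: the operator \<open>D\<^sub>2 F\<^sub>d\<close> is the restriction of \<open>D\<^sub>2 F\<close> to \<open>W\<^sub>d\<close>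
  (lemmas \<open>D2_restrict\<close>, \<open>D2_invariant\<close>). As restricting operators to \<open>W\<^sub>d\<close> is linear and
  norm-decreasing, the derivative of \<open>J\<close> as a function into \<open>L(W\<^sub>d)\<close> is the restriction to \<open>W\<^sub>d\<close> of
  the derivative taken here.
\<close>

definition J :: "(real \<times> 'a \<Rightarrow> 'a) \<Rightarrow> (real \<Rightarrow> 'a) \<Rightarrow> real \<Rightarrow> 'a::real_normed_vector \<Rightarrow>\<^sub>L 'a" where
  "J F b s = D2 F (s, b s)"

definition J' :: "(real \<times> 'a \<Rightarrow> 'a) \<Rightarrow> (real \<Rightarrow> 'a) \<Rightarrow> real \<Rightarrow> 'a::real_normed_vector \<Rightarrow>\<^sub>L 'a" where
  "J' F b s = vector_derivative (J F b) (at s)"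

lemma D2_has_derivative:
  assumes "C2_on (I \<times> UNIV) F" "s \<in> I"
  shows "((\<lambda>x. F (s, x)) has_derivative blinfun_apply (D2 F (s, x))) (at x)"
proof -
  obtain f' where f': "(F has_derivative blinfun_apply (f' (s, x))) (at (s, x))"
    using assms unfolding C2_on_def by blast
  have p: "((\<lambda>y. (s, y)) has_derivative (\<lambda>h. (0, h))) (at x)"
    by (auto intro!: derivative_eq_intros)
  have "((\<lambda>y. F (s, y)) has_derivative (\<lambda>h. blinfun_apply (f' (s, x)) (0, h))) (at x)"
    using has_derivative_compose[OF p f'] .
  then have d: "((\<lambda>y. F (s, y)) has_derivative frechet_derivative (\<lambda>y. F (s, y)) (at x)) (at x)"
    using frechet_derivative_works differentiableI by blast
  then have "bounded_linear (frechet_derivative (\<lambda>y. F (s, y)) (at x))"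
    by (rule has_derivative_bounded_linear)
  with d show ?thesis
    by (simp add: D2_def bounded_linear_Blinfun_apply)
qed

lemma D2_restrict:
  assumes "C2_on (I \<times> UNIV) F" "s \<in> I"
  shows "((\<lambda>x. F (s, x)) has_derivative blinfun_apply (D2 F (s, x))) (at x within W)"
  using D2_has_derivative[OF assms] by (rule has_derivative_at_withinI)

lemma vector_derivative_in_closed_subspace:
  fixes f :: "real \<Rightarrow> 'a::real_normed_vector"
  assumes f: "(f has_vector_derivative v) (at t)"
    and W: "subspace W" "closed W"
    and T: "open T" "t \<in> T" "\<And>r. r \<in> T \<Longrightarrow> f r \<in> W"
  shows "v \<in> W"
proof -
  define q where "q h = (f (t + h) - f t) /\<^sub>R h" for h
  have "((\<lambda>h. norm (f (t + h) - f t - h *\<^sub>R v) / norm h) \<longlongrightarrow> 0) (at 0)"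
    using f by (simp add: has_vector_derivative_def has_derivative_at)
  moreover have "norm (f (t + h) - f t - h *\<^sub>R v) / norm h = norm (q h - v)" if "h \<noteq> 0" for h
  proof -
    have "q h - v = (f (t + h) - f t - h *\<^sub>R v) /\<^sub>R h"
      using that by (simp add: q_def scaleR_diff_right)
    then show ?thesis
      by (simp add: divide_inverse mult.commute)
  qed
  ultimately have "((\<lambda>h. norm (q h - v)) \<longlongrightarrow> 0) (at 0)"
    by (subst LIM_equal[where g = "\<lambda>h. norm (f (t + h) - f t - h *\<^sub>R v) / norm h"]) auto
  then have lim: "(q \<longlongrightarrow> v) (at 0)"
    by (simp add: tendsto_norm_zero_iff LIM_zero_iff)
  have "((\<lambda>h. t + h) \<longlongrightarrow> t + 0) (at 0)"
    by (intro tendsto_intros)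
  then have "\<forall>\<^sub>F h in at 0. t + h \<in> T"
    using T(1,2) by (auto dest: topological_tendstoD)
  then have "\<forall>\<^sub>F h in at 0. q h \<in> W"
    by eventually_elim
       (auto simp: q_def intro!: subspace_scale[OF W(1)] subspace_diff[OF W(1)] T)
  from Lim_in_closed_set[OF W(2) this _ lim] show ?thesis
    by simp
qed

lemma D2_invariant:
  assumes "C2_on (I \<times> UNIV) F" "s \<in> I" "F_invariant I F W" "closed W" "x \<in> W" "w \<in> W"
  shows "blinfun_apply (D2 F (s, x)) w \<in> W"
proof (rule vector_derivative_in_closed_subspace)
  have l: "((\<lambda>h. x + h *\<^sub>R w) has_derivative (\<lambda>h. h *\<^sub>R w)) (at (0::real))"
    by (auto intro!: derivative_eq_intros)
  have d: "((\<lambda>y. F (s, y)) has_derivative blinfun_apply (D2 F (s, x))) (at (x + 0 *\<^sub>R w))"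
    using D2_has_derivative[OF assms(1,2), of x] by simp
  show "((\<lambda>h. F (s, x + h *\<^sub>R w)) has_vector_derivative blinfun_apply (D2 F (s, x)) w) (at 0)"
    using has_derivative_compose[OF l d]
    by (simp add: has_vector_derivative_def blinfun.scaleR_right)
  show "subspace W" "closed W" "open UNIV" "0 \<in> UNIV"
    using assms by (auto simp: F_invariant_def)
  show "F (s, x + h *\<^sub>R w) \<in> W" for h
    using assms by (auto simp: F_invariant_def intro!: subspace_add subspace_scale)
qed

end

(*
Subtracting the mother branch and dividing by the amplitude removes the trivial solutions: by the
mean value formula F (s, b s + y) = M (s, y) y with the C1 operator function
M (s, y) = integral of D2 F (s, b s + t y) over 0 <= t <= 1, so for y = alpha (x0 + z) with alpha
nonzero the equation F = 0 becomes G (alpha, s, z) = M (s, alpha (x0 + z)) (x0 + z) = 0. At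
(0, s_star, 0) the partial derivative of G in (s, z) is
(sigma, zeta) |-> sigma J'(s_star) x0 + J(s_star) zeta,
which conditions (a) and (b) make a bijection from R x Z onto W_d, with bounded inverse by the open
mapping theorem. The implicit function theorem then gives s = phi(alpha), z = psi(alpha).
A solution curve through the bifurcation point cannot switch branches there, as the tangents
of the two branches differ, nor anywhere else, as the branches do not meet again.
*)
theory Submission
  imports Defs
begin

text \<open>\<open>W_d\<close> and \<open>Z\<close> are closed subspaces given as sets, while
  \<open>F\<close>, its derivatives and the operators \<open>M\<close> act on the whole space. Only
  restrictions are invertible, so the open mapping and implicit function theorems are proved
  relative to subspaces; invariance and closedness keep values and derivatives inside
  \<open>W_d\<close>. Factoring out the amplitude costs one derivative: \<open>M\<close> is an
  average of \<open>D2 F\<close>, so a C2 map \<open>F\<close> gives C1 functions \<phi> and \<psi>.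
  Uniqueness of the implicit function concerns the rescaled unknown z in a fixed ball, whereas a
  zero close to the bifurcation point only has a small y. That z lies in this ball needs a separate
  estimate, based on the lower bound for the linearization on \<open>Z\<close>. That the branches do
  not meet again does not yet stop a curve from switching: points of one branch might accumulate at
  the other. A cone excludes this: on the daughter branch the distance of s from
  \<open>s_star\<close> is at most a constant times the distance of x from b(s), because \<phi> is
  Lipschitz and \<open>-x0\<close> has positive distance from \<open>Z\<close>.\<close>

section \<open>The open mapping theorem for closed subspaces\<close>

text \<open>By Baire's theorem in \<open>W\<close>, the closure of the image of some ball of
  \<open>Y\<close> has interior points relative to \<open>W\<close>. Convexity and symmetry give a
  neighborhood of 0, and a geometric series of corrections, convergent in \<open>Y\<close>, removes
  the closure. The conclusion is solvability with a norm bound; together with injectivity it becomes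
  a bounded inverse.\<close>

lemma open_mapping_closed_subspace:
  fixes L :: "'a::banach \<Rightarrow>\<^sub>L 'b::banach"
  assumes Y: "subspace Y" "closed Y" and W: "closed W" and im: "blinfun_apply L ` Y = W"
  obtains C where "C > 0" "\<And>w. w \<in> W \<Longrightarrow> \<exists>y\<in>Y. blinfun_apply L y = w \<and> norm y \<le> C * norm w"
proof -
  have subW: "subspace W"
    unfolding im[symmetric]
    by (intro linear_subspace_image Y bounded_linear.linear) (rule blinfun.bounded_linear_right)
  define A where "A n = closure (blinfun_apply L ` (Y \<inter> cball 0 (real n)))" for n :: nat
  have AW: "A n \<subseteq> W" for n
    unfolding A_def using im W by (intro closure_minimal) auto
  have UA: "(\<Union>n. A n) = W"
  proof
    show "W \<subseteq> (\<Union>n. A n)"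
    proof
      fix w assume "w \<in> W"
      then obtain y where y: "y \<in> Y" "w = L y" using im by auto
      obtain n where "norm y \<le> real n" using real_arch_simple by blast
      then have "w \<in> blinfun_apply L ` (Y \<inter> cball 0 (real n))" using y by auto
      then have "w \<in> A n" unfolding A_def by (rule subsetD[OF closure_subset])
      then show "w \<in> (\<Union>n. A n)" by blast
    qed
  qed (use AW in auto)
  have "\<exists>n. top_of_set W interior_of A n \<noteq> {}"
  proof (rule ccontr)
    assume "\<nexists>n. top_of_set W interior_of A n \<noteq> {}"
    then have "top_of_set W interior_of \<Union>(range A) = {}"
      using AW W
      by (intro Baire_category_alt)
         (auto simp: A_def closed_subset completely_metrizable_space_closedin completely_metrizable_space_euclidean)
    moreover have "top_of_set W interior_of W = W"
      by (metis interior_of_topspace topspace_euclidean_subtopology)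
    ultimately show False using UA subspace_0[OF subW] by auto
  qed
  then obtain n w0 where "w0 \<in> top_of_set W interior_of A n" by blast
  then obtain T where T: "openin (top_of_set W) T" "w0 \<in> T" "T \<subseteq> A n"
    by (auto simp: interior_of_def)
  then obtain d where d: "d > 0" "ball w0 d \<inter> W \<subseteq> T" and w0: "w0 \<in> W"
    by (meson openin_contains_ball openin_imp_subset subsetD)
  have cA: "convex (A n)"
    unfolding A_def using Y(1)
    by (intro convex_closure convex_linear_image convex_Int convex_cball bounded_linear.linear blinfun.bounded_linear_right)
       (simp add: subspace_imp_convex)
  have sA: "- v \<in> A n" if "v \<in> A n" for v
  proof -
    have "(\<lambda>x. - x) ` (blinfun_apply L ` (Y \<inter> cball 0 (real n))) \<subseteq> blinfun_apply L ` (Y \<inter> cball 0 (real n))"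
      using subspace_neg[OF Y(1)] by (force simp: blinfun.minus_right[symmetric])
    then have "closure ((\<lambda>x. - x) ` (blinfun_apply L ` (Y \<inter> cball 0 (real n)))) \<subseteq> A n"
      unfolding A_def by (rule closure_mono)
    then show ?thesis
      using that closure_scaleR[of "-1" "blinfun_apply L ` (Y \<inter> cball 0 (real n))"]
      by (auto simp: A_def)
  qed
  \<comment> \<open>The ball around \<open>w0\<close> is moved to the origin: \<open>v\<close> is
    the midpoint of \<open>w0 + v\<close> and the reflection of \<open>w0 - v\<close>.\<close>
  have dA: "v \<in> A n" if "v \<in> W" "norm v < d" for v
  proof -
    have "w0 + v \<in> A n" "w0 - v \<in> A n"
      using d T that w0 subspace_add[OF subW w0] subspace_diff[OF subW w0]
      by (auto simp: subset_iff dist_norm)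
    then have "(1/2) *\<^sub>R (w0 + v) + (1/2) *\<^sub>R (- (w0 - v)) \<in> A n"
      by (intro convexD[OF cA] sA) auto
    moreover have "(1/2) *\<^sub>R (w0 + v) + (1/2) *\<^sub>R (- (w0 - v)) = v"
      by (simp add: algebra_simps flip: scaleR_add_left)
    ultimately show ?thesis by simp
  qed
  \<comment> \<open>A vector \<open>w\<close> is scaled to norm \<open>d / 2\<close> and
    approximated up to \<open>d / 4\<close> by the image of a vector of norm at most
    \<open>n\<close>; scaling back leaves an error of at most half of \<open>norm w\<close>. The
    summand 1 keeps \<open>c\<close> positive for \<open>n = 0\<close>.\<close>
  define c where "c = 2 * (real n + 1) / d"
  have c: "c > 0" using d by (simp add: c_def)
  have "\<exists>y\<in>Y. norm y \<le> c * norm w \<and> norm (w - L y) \<le> norm w / 2" if w: "w \<in> W" for w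
  proof (cases "w = 0")
    case True
    then show ?thesis using subspace_0[OF Y(1)] by (intro bexI[of _ 0]) auto
  next
    case False
    define u where "u = (d / (2 * norm w)) *\<^sub>R w"
    have "u \<in> A n"
      using d w subW False by (intro dA) (auto simp: u_def subspace_scale)
    then obtain y where y: "y \<in> Y" "norm y \<le> real n" "norm (u - L y) < d / 4"
    proof -
      from \<open>u \<in> A n\<close> obtain v where "v \<in> blinfun_apply L ` (Y \<inter> cball 0 (real n))" "dist v u < d / 4"
        unfolding A_def closure_approachable using d by (meson divide_pos_pos zero_less_numeral)
      then show thesis using that by (auto simp: dist_norm norm_minus_commute)
    qed
    let ?y = "(2 * norm w / d) *\<^sub>R y"
    have "w - L ?y = (2 * norm w / d) *\<^sub>R (u - L y)"
      using d False by (simp add: u_def blinfun.scaleR_right scaleR_diff_right)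
    then have "norm (w - L ?y) \<le> (2 * norm w / d) * (d / 4)"
      using y d by (simp only: norm_scaleR) (intro mult_mono, auto)
    moreover have "norm ?y \<le> (2 * norm w / d) * (real n + 1)"
      using y d by (simp only: norm_scaleR) (intro mult_mono, auto)
    ultimately show ?thesis
      using d y subspace_scale[OF Y(1)] by (intro bexI[of _ ?y]) (auto simp: c_def field_simps)
  qed
  then obtain s where s: "\<And>w. w \<in> W \<Longrightarrow> s w \<in> Y" "\<And>w. w \<in> W \<Longrightarrow> norm (s w) \<le> c * norm w"
    "\<And>w. w \<in> W \<Longrightarrow> norm (w - L (s w)) \<le> norm w / 2"
    by metis
  show thesis
  proof
    show "2 * c > 0" using c by simp
    fix w assume w: "w \<in> W"
    \<comment> \<open>\<open>r k\<close> is the residual after \<open>k\<close> corrections. It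
      halves each time, so the corrections are dominated by a geometric series, whose sum produces
      the factor 2 in \<open>2 * c\<close>.\<close>
    define r where "r = rec_nat w (\<lambda>_ v. v - L (s v))"
    have r_Suc: "r (Suc k) = r k - L (s (r k))" and r0: "r 0 = w" for k by (simp_all add: r_def)
    have LW: "L y \<in> W" if "y \<in> Y" for y using that im by blast
    have rW: "r k \<in> W" for k
      by (induction k) (simp_all add: r0 r_Suc w s(1) LW subspace_diff[OF subW])
    have rn: "norm (r k) \<le> norm w * (1/2)^k" for k
    proof (induction k)
      case (Suc k)
      then show ?case using s(3)[OF rW[of k]] by (simp add: r_Suc)
    qed (simp add: r0)
    define y where "y k = s (r k)" for k
    have yn: "norm (y k) \<le> c * norm w * (1/2)^k" for k
      using order_trans[OF s(2)[OF rW[of k]] mult_left_mono[OF rn[of k], of c]] c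
      by (simp add: y_def mult.assoc)
    have sm: "summable (\<lambda>k. c * norm w * (1/2::real)^k)" by (intro summable_mult) auto
    have sy: "summable y" by (rule summable_comparison_test[OF _ sm]) (use yn in auto)
    have "suminf y \<in> Y"
    proof (rule closed_sequentially[OF Y(2)])
      show "(\<lambda>k. \<Sum>i<k. y i) \<longlonglongrightarrow> suminf y" by (rule summable_LIMSEQ[OF sy])
      show "(\<Sum>i<k. y i) \<in> Y" for k
        using s(1)[OF rW] by (intro subspace_sum[OF Y(1)]) (auto simp: y_def)
    qed
    moreover have "L (suminf y) = w"
    proof -
      have "(\<lambda>k. norm w * (1/2::real)^k) \<longlonglongrightarrow> norm w * 0" by (intro tendsto_intros LIMSEQ_power_zero) auto
      then have "r \<longlonglongrightarrow> 0"
        using rn by (intro Lim_null_comparison[of r "\<lambda>k. norm w * (1/2)^k" sequentially]) simp_all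
      then have "(\<lambda>k. r k - r (Suc k)) sums (r 0 - 0)" by (rule telescope_sums')
      moreover have "(\<lambda>k. L (y k)) sums L (suminf y)"
        by (intro bounded_linear.sums[OF blinfun.bounded_linear_right] summable_sums sy)
      moreover have "L (y k) = r k - r (Suc k)" for k by (simp add: r_Suc y_def)
      ultimately show ?thesis by (simp add: r0 sums_iff)
    qed
    moreover have "norm (suminf y) \<le> 2 * c * norm w"
    proof -
      have "norm (suminf y) \<le> (\<Sum>k. c * norm w * (1/2::real)^k)"
        by (rule norm_suminf_le[OF yn sm])
      also have "\<dots> = 2 * c * norm w" by (subst suminf_mult) (auto simp: suminf_geometric)
      finally show ?thesis .
    qed
    ultimately show "\<exists>y\<in>Y. L y = w \<and> norm y \<le> 2 * c * norm w" by blast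
  qed
qed

section \<open>The implicit function theorem on closed subspaces\<close>

text \<open>This is Newton's iteration with the derivative frozen at \<open>A\<close>: the map
  taking y to y minus the \<open>A\<close>-preimage of \<open>f y\<close> is a contraction with
  factor 1/2 on the closed ball by \<open>lip\<close>, and \<open>small\<close> makes it map the
  ball into itself. It serves both for the implicit function and for its derivative.\<close>

lemma zero_of_perturbed_bijection:
  fixes A :: "'b::banach \<Rightarrow>\<^sub>L 'c::real_normed_vector"
  assumes Y: "subspace Y" "closed Y" and W: "subspace W"
    and A: "blinfun_apply A ` Y = W" "\<And>y. y \<in> Y \<Longrightarrow> norm y \<le> C * norm (A y)"
    and y0: "y0 \<in> Y" and r: "r \<ge> 0"
    and f: "\<And>y. y \<in> Y \<Longrightarrow> norm (y - y0) \<le> r \<Longrightarrow> f y \<in> W"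
    and lip: "\<And>y z. y \<in> Y \<Longrightarrow> z \<in> Y \<Longrightarrow> norm (y - y0) \<le> r \<Longrightarrow> norm (z - y0) \<le> r \<Longrightarrow>
         C * norm (A (y - z) - (f y - f z)) \<le> norm (y - z) / 2"
    and small: "C * norm (f y0) \<le> r / 2"
  obtains y where "y \<in> Y" "norm (y - y0) \<le> r" "f y = 0"
proof -
  have inj: "y = z" if "y \<in> Y" "z \<in> Y" "A y = A z" for y z
    using A(2)[of "y - z"] that subspace_diff[OF Y(1)] by (simp add: blinfun.diff_right)
  \<comment> \<open>\<open>S\<close> inverts \<open>A\<close> from \<open>W\<close> to
    \<open>Y\<close>. Its arbitrary values outside \<open>W\<close> do not matter, since
    \<open>f\<close> maps the ball into \<open>W\<close>.\<close>
  define S where "S w = (SOME y. y \<in> Y \<and> A y = w)" for w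
  have S: "S w \<in> Y" "A (S w) = w" if "w \<in> W" for w
    using someI_ex[of "\<lambda>y. y \<in> Y \<and> A y = w"] that A(1) by (auto simp: S_def)
  define K where "K = Y \<inter> cball y0 r"
  have K: "y \<in> K \<longleftrightarrow> y \<in> Y \<and> norm (y - y0) \<le> r" for y
    by (auto simp: K_def dist_norm norm_minus_commute)
  define T where "T y = y - S (f y)" for y
  have TY: "T y \<in> Y" if "y \<in> K" for y
    using that f S by (auto simp: T_def K intro!: subspace_diff[OF Y(1)])
  have con: "norm (T y - T z) \<le> (1/2) * norm (y - z)" if "y \<in> K" "z \<in> K" for y z
  proof -
    have "A (T y - T z) = A (y - z) - (f y - f z)"
      using that f S by (auto simp: T_def K blinfun.diff_right)
    then show ?thesis
      using A(2)[of "T y - T z"] lip[of y z] that TY[of y] TY[of z] subspace_diff[OF Y(1)]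
      by (auto simp: K)
  qed
  have "y0 \<in> K" using y0 r by (simp add: K)
  have TK: "T y \<in> K" if "y \<in> K" for y
  proof -
    have "norm (T y0 - y0) \<le> r / 2"
      using A(2)[of "T y0 - y0"] small S(1,2)[OF f[OF y0]] r subspace_neg[OF Y(1)]
      by (auto simp: T_def blinfun.minus_right)
    moreover have "norm (T y - T y0) \<le> r / 2"
      using con[OF that \<open>y0 \<in> K\<close>] that by (simp add: K)
    ultimately have "norm (T y - y0) \<le> r"
      using norm_triangle_ineq[of "T y - T y0" "T y0 - y0"] by simp
    then show ?thesis using TY[OF that] by (simp add: K)
  qed
  have "\<exists>!y\<in>K. T y = y"
  proof (rule Banach_fix)
    show "complete K"
      using Y(2) by (simp add: K_def closed_Int complete_eq_closed)
    show "dist (T x) (T y) \<le> 1/2 * dist x y" if "x \<in> K" "y \<in> K" for x y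
      using con[OF that] by (simp add: dist_norm)
  qed (use \<open>y0 \<in> K\<close> TK in auto)
  then obtain y where y: "y \<in> K" "T y = y" by blast
  then have "S (f y) = 0" by (simp add: T_def)
  then have "f y = 0" using S(2)[of "f y"] f[of y] y(1) by (auto simp: K)
  then show thesis using that y by (auto simp: K)
qed

text \<open>On a small box, \<open>G'\<close> differs from its value at the base point by so little
  that invertibility from \<open>Y\<close> onto \<open>W\<close> persists with uniform constants.
  The bound with \<open>C\<close> expresses a bounded inverse. Uniqueness holds in a ball of radius
  \<open>r\<close> that is the same for all parameters, which is what the later description of the
  zeros relies on.\<close>

theorem implicit_function_closed_subspace:
  fixes G :: "real \<times> 'b::banach \<Rightarrow> 'c::banach" and G' :: "real \<times> 'b \<Rightarrow> (real \<times> 'b) \<Rightarrow>\<^sub>L 'c"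
  assumes Y: "subspace Y" "closed Y" and W: "subspace W" "closed W"
    and \<Omega>: "open \<Omega>" "(t0, y0) \<in> \<Omega>" and y0: "y0 \<in> Y"
    and der: "\<And>p. p \<in> \<Omega> \<Longrightarrow> (G has_derivative blinfun_apply (G' p)) (at p)"
    and cont: "continuous_on \<Omega> G'"
    and GW: "\<And>t y. (t, y) \<in> \<Omega> \<Longrightarrow> y \<in> Y \<Longrightarrow> G (t, y) \<in> W"
    and zero: "G (t0, y0) = 0"
    and surj: "(\<lambda>y. blinfun_apply (G' (t0, y0)) (0, y)) ` Y = W"
    and C: "C > 0" "\<And>y. y \<in> Y \<Longrightarrow> norm y \<le> C * norm (blinfun_apply (G' (t0, y0)) (0, y))"
  obtains a r L g g' where
    "\<And>t. \<bar>t - t0\<bar> < a \<Longrightarrow> (g has_vector_derivative g' t) (at t)"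
    "continuous_on {t0 - a<..<t0 + a} g'"
    "\<And>s t. \<bar>s - t0\<bar> < a \<Longrightarrow> \<bar>t - t0\<bar> < a \<Longrightarrow> norm (g s - g t) \<le> L * \<bar>s - t\<bar>"
    "a > 0" "g t0 = y0"
    "\<And>t. \<bar>t - t0\<bar> < a \<Longrightarrow> (t, g t) \<in> \<Omega> \<and> g t \<in> Y \<and> G (t, g t) = 0"
    "\<And>t y. \<bar>t - t0\<bar> < a \<Longrightarrow> y \<in> Y \<Longrightarrow> norm (y - y0) \<le> r \<Longrightarrow> G (t, y) = 0 \<Longrightarrow> y = g t"
    "r > 0"
proof -
  let ?base = "(t0, y0)"
  \<comment> \<open>With \<open>C * \<epsilon> = 1/2\<close> the perturbation of the derivative,
    measured after applying the inverse, is a contraction by 1/2.\<close>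
  define \<epsilon> where "\<epsilon> = 1 / (2 * C)"
  have \<epsilon>: "\<epsilon> > 0" "C * \<epsilon> = 1/2" using C by (auto simp: \<epsilon>_def)
  have inr: "bounded_linear (\<lambda>y::'b. (0::real, y))"
    by (intro bounded_linear_Pair bounded_linear_zero bounded_linear_ident)
  define A where "A p = G' p o\<^sub>L Blinfun (\<lambda>y. (0, y))" for p
  have A: "A p y = G' p (0, y)" for p y
    by (simp add: A_def bounded_linear_Blinfun_apply[OF inr])
  have "isCont G' ?base" using cont \<Omega> by (simp add: continuous_on_eq_continuous_at)
  then obtain d1 where d1: "d1 > 0" "\<And>p. dist p ?base < d1 \<Longrightarrow> dist (G' p) (G' ?base) < \<epsilon>"
    using \<epsilon>(1) unfolding continuous_at_eps_delta by blast
  obtain d2 where d2: "d2 > 0" "ball ?base d2 \<subseteq> \<Omega>" using \<Omega> openE by blast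
  \<comment> \<open>Halving lets the two coordinates of a point of the box \<open>B\<close> add up
    to less than \<open>d1\<close> and \<open>d2\<close>.\<close>
  define r where "r = min d1 d2 / 2"
  have r: "r > 0" using d1 d2 by (simp add: r_def)
  define B where "B = ball t0 r \<times> cball y0 r"
  have B: "(t, y) \<in> B \<longleftrightarrow> \<bar>t - t0\<bar> < r \<and> norm (y - y0) \<le> r" for t y
    by (auto simp: B_def dist_norm norm_minus_commute abs_minus_commute)
  have near: "p \<in> \<Omega> \<and> norm (G' p - G' ?base) \<le> \<epsilon>" if "p \<in> B" for p
  proof -
    obtain t y where p: "p = (t, y)" by force
    have "dist p ?base < d1" "dist p ?base < d2"
      using that norm_Pair_le[of "t - t0" "y - y0"] by (auto simp: p B dist_norm r_def)
    then show ?thesis using d1(2)[of p] d2(2) by (auto simp: dist_norm norm_minus_commute)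
  qed
  have cB: "convex B" unfolding B_def by (intro convex_Times convex_ball convex_cball)
  \<comment> \<open>The mean value inequality is applied to \<open>G\<close> minus its linearization
    at the base point, whose derivative has norm at most \<epsilon> on the convex box.\<close>
  have lin: "norm (G p - G q - G' ?base (p - q)) \<le> \<epsilon> * norm (p - q)" if "p \<in> B" "q \<in> B" for p q
  proof -
    have "norm ((G p - G' ?base p) - (G q - G' ?base q)) \<le> \<epsilon> * norm (p - q)"
    proof (rule differentiable_bound[OF cB _ _ that])
      fix x assume x: "x \<in> B"
      show "((\<lambda>p. G p - G' ?base p) has_derivative blinfun_apply (G' x - G' ?base)) (at x within B)"
        using has_derivative_at_withinI[OF der, of x B] near[OF x]
        unfolding blinfun.diff_left
        by (intro has_derivative_diff bounded_linear_imp_has_derivative blinfun.bounded_linear_right) auto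
      show "onorm (blinfun_apply (G' x - G' ?base)) \<le> \<epsilon>"
        using near[OF x] by (simp add: norm_blinfun.rep_eq)
    qed
    then show ?thesis by (simp add: blinfun.diff_right algebra_simps)
  qed
  define M where "M = norm (G' ?base) + \<epsilon>"
  have M: "M > 0" using \<epsilon> by (simp add: M_def add_nonneg_pos)
  have G'M: "norm (G' p) \<le> M" if "p \<in> B" for p
    using near[OF that] norm_triangle_ineq2[of "G' p" "G' ?base"] by (simp add: M_def)
  have GL: "norm (G p - G q) \<le> M * norm (p - q)" if "p \<in> B" "q \<in> B" for p q
    using lin[OF that] norm_blinfun[of "G' ?base" "p - q"] norm_triangle_ineq2[of "G p - G q" "G' ?base (p - q)"]
    by (simp add: M_def algebra_simps)
  have imA: "blinfun_apply (A ?base) ` Y = W" using surj by (simp add: A image_def)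
  have lipA: "C * norm (A ?base (y - z) - (G (t, y) - G (t, z))) \<le> norm (y - z) / 2"
    if "(t, y) \<in> B" "(t, z) \<in> B" for t y z
    using mult_left_mono[OF lin[OF that], of C] C \<epsilon>(2)
    by (simp add: A norm_minus_commute norm_Pair mult.assoc[symmetric])
  \<comment> \<open>For a fixed parameter, \<open>G\<close> is bounded below on differences of
    points of \<open>Y\<close>. Uniqueness of the zero and the Lipschitz bound for \<open>g\<close>
    both come from this inequality.\<close>
  have expand: "norm (y - z) \<le> 2 * C * norm (G (t, y) - G (t, z))"
    if "(t, y) \<in> B" "(t, z) \<in> B" "y \<in> Y" "z \<in> Y" for t y z
  proof -
    have "norm (y - z) \<le> C * norm (A ?base (y - z))"
      using C(2)[of "y - z"] that subspace_diff[OF Y(1)] by (simp add: A)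
    also have "\<dots> \<le> C * (norm (A ?base (y - z) - (G (t, y) - G (t, z))) + norm (G (t, y) - G (t, z)))"
      using C norm_triangle_sub[of "A ?base (y - z)" "G (t, y) - G (t, z)"] by (intro mult_left_mono) auto
    finally show ?thesis using lipA[OF that(1,2)] by (simp add: algebra_simps)
  qed
  \<comment> \<open>The choice makes \<open>M * \<bar>t - t0\<bar>\<close>, which bounds
    \<open>norm (G (t, y0))\<close>, at most \<open>r / (2 * C)\<close>; this is the smallness
    demanded by the fixed point lemma.\<close>
  define a where "a = min r (r / (2 * C * M))"
  have a: "a > 0" "a \<le> r" using r C M by (auto simp: a_def)
  have "\<exists>y. y \<in> Y \<and> norm (y - y0) \<le> r \<and> G (t, y) = 0" if t: "\<bar>t - t0\<bar> < a" for t
  proof -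
    have tB: "(t, y) \<in> B \<longleftrightarrow> norm (y - y0) \<le> r" for y using t a by (auto simp: B)
    have "norm (G (t, y0)) \<le> M * \<bar>t - t0\<bar>"
      using GL[of "(t, y0)" ?base] t a r by (auto simp: B zero norm_Pair)
    also have "\<dots> \<le> M * (r / (2 * C * M))" using t M by (intro mult_left_mono) (auto simp: a_def)
    finally have "C * norm (G (t, y0)) \<le> r / 2" using C M by (simp add: field_simps)
    then obtain y where "y \<in> Y" "norm (y - y0) \<le> r" "G (t, y) = 0"
      using C(2) y0 r GW near lipA tB
      by (elim zero_of_perturbed_bijection[OF Y W(1) imA, of C y0 r "\<lambda>y. G (t, y)", rotated -1]) (auto simp: A)
    then show ?thesis by blast
  qed
  then obtain g where g: "\<And>t. \<bar>t - t0\<bar> < a \<Longrightarrow> g t \<in> Y \<and> norm (g t - y0) \<le> r \<and> G (t, g t) = 0"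
    by metis
  have gB: "(t, y) \<in> B" if "\<bar>t - t0\<bar> < a" "norm (y - y0) \<le> r" for t y using that a by (auto simp: B)
  have uniq: "y = g t" if "\<bar>t - t0\<bar> < a" "y \<in> Y" "norm (y - y0) \<le> r" "G (t, y) = 0" for t y
    using expand[of t y "g t"] g[OF that(1)] that gB by simp
  \<comment> \<open>\<open>G\<close> is \<open>M\<close>-Lipschitz in the parameter and its zeros
    react with factor \<open>2 * C\<close>; the same number bounds the derivative of
    \<open>g\<close>.\<close>
  define L where "L = 2 * C * M"
  have L: "L > 0" using C M by (simp add: L_def)
  have gL: "norm (g s - g t) \<le> L * \<bar>s - t\<bar>" if "\<bar>s - t0\<bar> < a" "\<bar>t - t0\<bar> < a" for s t
  proof -
    have "norm (g s - g t) \<le> 2 * C * norm (G (t, g t) - G (s, g t))"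
      using expand[of s "g s" "g t"] g[OF that(1)] g[OF that(2)] that gB by simp
    also have "\<dots> \<le> 2 * C * (M * \<bar>s - t\<bar>)"
      using C GL[of "(t, g t)" "(s, g t)"] g[OF that(2)] that gB
      by (intro mult_left_mono) (auto simp: norm_Pair abs_minus_commute)
    finally show ?thesis by (simp add: L_def mult.assoc)
  qed
  \<comment> \<open>Along a line with direction in \<open>Y\<close>, the difference quotients of
    \<open>G\<close> lie in \<open>W\<close>, and \<open>W\<close> is closed.\<close>
  have AW: "G' (t, y) (s, v) \<in> W" if "(t, y) \<in> \<Omega>" "y \<in> Y" "v \<in> Y" for t y s v
  proof (rule vector_derivative_in_closed_subspace[OF _ W])
    have "((\<lambda>h. (t, y) + h *\<^sub>R (s, v)) has_derivative (\<lambda>h. h *\<^sub>R (s, v))) (at (0::real))"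
      by (auto intro!: derivative_eq_intros)
    from has_derivative_compose[OF this, of G "G' (t, y)"]
    show "((\<lambda>h. G ((t, y) + h *\<^sub>R (s, v))) has_vector_derivative G' (t, y) (s, v)) (at 0)"
      using der[OF that(1)] by (simp add: has_vector_derivative_def blinfun.scaleR_right[symmetric])
    show "open ((\<lambda>h. (t, y) + h *\<^sub>R (s, v)) -` \<Omega>)"
      by (intro open_vimage \<Omega> continuous_intros)
    show "G ((t, y) + h *\<^sub>R (s, v)) \<in> W" if "h \<in> (\<lambda>h. (t, y) + h *\<^sub>R (s, v)) -` \<Omega>" for h
      using that \<open>y \<in> Y\<close> \<open>v \<in> Y\<close>
      by (auto intro!: GW subspace_add[OF Y(1)] subspace_scale[OF Y(1)])
  qed (use that in simp)
  have lipA': "C * norm (A ?base v - A p v) \<le> norm v / 2" if "p \<in> B" for p v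
  proof -
    have "norm (A ?base v - A p v) \<le> norm (G' p - G' ?base) * norm v"
      using norm_blinfun[of "G' p - G' ?base" "(0, v)"]
      by (simp add: A blinfun.diff_left norm_minus_commute norm_Pair)
    also have "\<dots> \<le> \<epsilon> * norm v" using near[OF that] by (intro mult_right_mono) auto
    finally have "C * norm (A ?base v - A p v) \<le> C * (\<epsilon> * norm v)" using C by (intro mult_left_mono) auto
    then show ?thesis using \<epsilon>(2) by (simp add: mult.assoc[symmetric])
  qed
  have bij: "norm v \<le> 2 * C * norm (G' p (0, v))" if "p \<in> B" "v \<in> Y" for p v
  proof -
    have "norm v \<le> C * norm (A ?base v)" using C(2) that by (simp add: A)
    also have "\<dots> \<le> C * (norm (A ?base v - A p v) + norm (A p v))"
      using C norm_triangle_sub[of "A ?base v" "A p v"] by (intro mult_left_mono) auto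
    finally show ?thesis using lipA'[OF that(1), of v] by (simp add: algebra_simps A)
  qed
  \<comment> \<open>The candidate for the derivative solves the linear equation obtained by
    differentiating \<open>G (t, g t) = 0\<close>. Since only the operator at the base point is
    known to be onto \<open>W\<close>, the equation at a nearby point is solved by
    perturbation.\<close>
  have "\<exists>h. h \<in> Y \<and> G' (t, g t) (1, h) = 0 \<and> norm h \<le> L" if t: "\<bar>t - t0\<bar> < a" for t
  proof -
    let ?p = "(t, g t)"
    have p: "?p \<in> B" using gB g[OF t] t by blast
    have nb: "norm (G' ?p (1, 0)) \<le> M"
      using norm_blinfun[of "G' ?p" "(1, 0)"] G'M[OF p] by (simp add: norm_Pair)
    obtain h where h: "h \<in> Y" "norm (h - 0) \<le> L" "G' ?p (1, h) = 0"
    proof (rule zero_of_perturbed_bijection[OF Y W(1) imA, of C 0 L "\<lambda>h. G' ?p (1, h)"])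
      show "norm y \<le> C * norm (A ?base y)" if "y \<in> Y" for y using C(2) that by (simp add: A)
      show "C * norm (G' ?p (1, 0)) \<le> L / 2"
        using nb C by (simp add: L_def)
      show "G' ?p (1, y) \<in> W" if "y \<in> Y" for y using AW near[OF p] g[OF t] that by auto
      fix y z :: 'b
      have "G' ?p (1, y) - G' ?p (1, z) = A ?p (y - z)"
        by (simp add: A flip: blinfun.diff_right)
      then show "C * norm (A ?base (y - z) - (G' ?p (1, y) - G' ?p (1, z))) \<le> norm (y - z) / 2"
        using lipA'[OF p] by simp
    qed (use subspace_0[OF Y(1)] L in auto)
    then show ?thesis by auto
  qed
  then obtain g' where g': "\<And>t. \<bar>t - t0\<bar> < a \<Longrightarrow> g' t \<in> Y \<and> G' (t, g t) (1, g' t) = 0 \<and> norm (g' t) \<le> L"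
    by metis
  have split: "G' p (s, v) = s *\<^sub>R G' p (1, u) + G' p (0, v - s *\<^sub>R u)" for p s u v
    by (simp flip: blinfun.scaleR_right blinfun.add_right)
  have dg: "(g has_vector_derivative g' t) (at t)" if t: "\<bar>t - t0\<bar> < a" for t
    unfolding has_vector_derivative_def has_derivative_at_alt
  proof (intro conjI allI impI)
    show "bounded_linear (\<lambda>x. x *\<^sub>R g' t)" by (rule bounded_linear_scaleR_left)
    fix e :: real assume e: "e > 0"
    let ?p = "(t, g t)"
    have p: "?p \<in> B" using gB g[OF t] t by blast
    \<comment> \<open>The factor \<open>2 * C\<close> comes from \<open>bij\<close>, and
      \<open>1 + L\<close> from the Lipschitz bound for the curve \<open>(t, g t)\<close>.\<close>
    define e' where "e' = e / (2 * C * (1 + L))"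
    have e': "e' > 0" using e C L by (simp add: e'_def)
    obtain d where d: "d > 0"
      "\<And>q. norm (q - ?p) < d \<Longrightarrow> norm (G q - G ?p - G' ?p (q - ?p)) \<le> e' * norm (q - ?p)"
      using der[of ?p] near[OF p] e' unfolding has_derivative_at_alt by blast
    define d' where "d' = min (d / (1 + L)) (a - \<bar>t - t0\<bar>)"
    have d': "d' > 0" using d L t by (simp add: d'_def)
    have "norm (g s - g t - (s - t) *\<^sub>R g' t) \<le> e * norm (s - t)" if s: "norm (s - t) < d'" for s
    proof -
      have s0: "\<bar>s - t0\<bar> < a" using s t by (auto simp: d'_def)
      let ?q = "(s, g s)"
      have n: "norm (?q - ?p) \<le> (1 + L) * \<bar>s - t\<bar>"
        using norm_Pair_le[of "s - t" "g s - g t"] gL[OF s0 t] by (simp add: algebra_simps)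
      also have "\<dots> < d" using s L by (simp add: d'_def field_simps)
      finally have "norm (G ?q - G ?p - G' ?p (?q - ?p)) \<le> e' * norm (?q - ?p)" by (rule d(2))
      moreover have "G ?q = 0" "G ?p = 0" using g[OF s0] g[OF t] by auto
      ultimately have "norm (G' ?p (?q - ?p)) \<le> e' * ((1 + L) * \<bar>s - t\<bar>)"
        using order_trans[OF _ mult_left_mono[OF n, of e']] e' by simp
      moreover have "G' ?p (?q - ?p) = G' ?p (0, g s - g t - (s - t) *\<^sub>R g' t)"
        using split[of ?p "s - t" "g s - g t" "g' t"] g'[OF t] by simp
      ultimately have "norm (G' ?p (0, g s - g t - (s - t) *\<^sub>R g' t)) \<le> e' * ((1 + L) * \<bar>s - t\<bar>)" by simp
      then have "2 * C * norm (G' ?p (0, g s - g t - (s - t) *\<^sub>R g' t)) \<le> 2 * C * (e' * ((1 + L) * \<bar>s - t\<bar>))"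
        using C by (intro mult_left_mono) auto
      also have "\<dots> = e * \<bar>s - t\<bar>" using C L by (simp add: e'_def)
      finally show ?thesis
        using bij[OF p, of "g s - g t - (s - t) *\<^sub>R g' t"] g[OF t] g[OF s0] g'[OF t]
          subspace_diff[OF Y(1)] subspace_scale[OF Y(1)] by auto
    qed
    then show "\<exists>d>0. \<forall>y. norm (y - t) < d \<longrightarrow> norm (g y - g t - (y - t) *\<^sub>R g' t) \<le> e * norm (y - t)"
      using d' by blast
  qed
  have cg': "continuous_on {t0 - a<..<t0 + a} g'"
  proof -
    have I: "t \<in> {t0 - a<..<t0 + a} \<longleftrightarrow> \<bar>t - t0\<bar> < a" for t by auto
    have "continuous_on {t0 - a<..<t0 + a} (\<lambda>t. G' (t, g t))"
    proof (rule continuous_on_compose2[OF cont])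
      show "continuous_on {t0 - a<..<t0 + a} (\<lambda>t. (t, g t))"
        using has_vector_derivative_continuous[OF dg]
        by (intro continuous_intros continuous_at_imp_continuous_on) (auto simp: abs_less_iff)
    qed (use near gB g in \<open>auto simp: I\<close>)
    note cG = this[unfolded continuous_on_def, rule_format]
    have "((\<lambda>s. g' s - g' t) \<longlongrightarrow> 0) (at t within {t0 - a<..<t0 + a})"
      if "t \<in> {t0 - a<..<t0 + a}" for t
    proof (rule Lim_null_comparison)
      have t: "\<bar>t - t0\<bar> < a" using that by (simp only: I)
      show "((\<lambda>s. 2 * C * (norm (G' (s, g s) - G' (t, g t)) * (1 + L))) \<longlongrightarrow> 0) (at t within {t0 - a<..<t0 + a})"
        using cG[OF that] by (intro tendsto_mult_right_zero tendsto_mult_left_zero tendsto_norm_zero) (simp add: LIM_zero)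
      have "norm (g' s - g' t) \<le> 2 * C * (norm (G' (s, g s) - G' (t, g t)) * (1 + L))"
        if "s \<in> {t0 - a<..<t0 + a}" for s
      proof -
        have s: "\<bar>s - t0\<bar> < a" using that by (simp only: I)
        have p: "(t, g t) \<in> B" using gB g[OF t] t by blast
        \<comment> \<open>Both tangents are annihilated by the derivative at their own point, so the
          difference \<open>g' s - g' t\<close> is controlled by the change of \<open>G'\<close>
          between the two points.\<close>
        have "G' (t, g t) (0, g' s - g' t) = G' (t, g t) (1, g' s)"
          using split[of "(t, g t)" 1 "g' s" "g' t"] g'[OF t] by simp
        also have "\<dots> = - (G' (s, g s) - G' (t, g t)) (1, g' s)"
          using g'[OF s] by (simp add: blinfun.diff_left)
        finally have "norm (G' (t, g t) (0, g' s - g' t)) \<le> norm (G' (s, g s) - G' (t, g t)) * norm (1::real, g' s)"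
          using norm_blinfun[of "G' (s, g s) - G' (t, g t)" "(1, g' s)"] by simp
        also have "\<dots> \<le> norm (G' (s, g s) - G' (t, g t)) * (1 + L)"
          using norm_Pair_le[of "1::real" "g' s"] g'[OF s] by (intro mult_left_mono) auto
        finally have "2 * C * norm (G' (t, g t) (0, g' s - g' t)) \<le> 2 * C * (norm (G' (s, g s) - G' (t, g t)) * (1 + L))"
          using C by (intro mult_left_mono) auto
        then show ?thesis
          using bij[OF p, of "g' s - g' t"] g'[OF s] g'[OF t] subspace_diff[OF Y(1)] by auto
      qed
      then show "\<forall>\<^sub>F s in at t within {t0 - a<..<t0 + a}. norm (g' s - g' t) \<le> 2 * C * (norm (G' (s, g s) - G' (t, g t)) * (1 + L))"
        by (auto simp: eventually_at_filter)
    qed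
    then show ?thesis by (auto simp: continuous_on_def LIM_zero_iff)
  qed
  have "g t0 = y0" using uniq[of t0 y0] y0 r a zero by simp
  with a r show thesis
    using g near gB by (intro that[of a g g' L r] uniq dg cg' gL) blast+
qed

section \<open>Continuously differentiable maps\<close>

text \<open>The derivative is operator-valued and continuous in the operator norm, so maps into
  spaces of operators are covered. It is the full derivative at every point even if \<open>S\<close>
  is not open, which admits domains such as \<open>S \<times> {a..b}\<close>.\<close>

definition C1_on :: "'a::real_normed_vector set \<Rightarrow> ('a \<Rightarrow> 'b::real_normed_vector) \<Rightarrow> bool" where
  "C1_on S f \<longleftrightarrow>
     (\<exists>f' :: 'a \<Rightarrow> 'a \<Rightarrow>\<^sub>L 'b.
        (\<forall>x\<in>S. (f has_derivative blinfun_apply (f' x)) (at x)) \<and> continuous_on S f')"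

lemma C1_on_continuous_on: "C1_on S f \<Longrightarrow> continuous_on S f"
  unfolding C1_on_def
  by (meson continuous_at_imp_continuous_on has_derivative_continuous)

lemma C1_on_cong:
  assumes "open S" "C1_on S f" "\<And>x. x \<in> S \<Longrightarrow> f x = g x"
  shows "C1_on S g"
proof -
  obtain f' where f': "\<And>x. x \<in> S \<Longrightarrow> (f has_derivative blinfun_apply (f' x)) (at x)" "continuous_on S f'"
    using assms(2) unfolding C1_on_def by blast
  have "(g has_derivative blinfun_apply (f' x)) (at x)" if "x \<in> S" for x
    by (rule has_derivative_transform_within_open[OF f'(1)[OF that] assms(1) that assms(3)])
  with f'(2) show ?thesis unfolding C1_on_def by blast
qed

lemma C1_on_compose:
  assumes "C1_on T g" "C1_on S f" "f ` S \<subseteq> T"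
  shows "C1_on S (\<lambda>x. g (f x))"
proof -
  obtain f' where f': "\<And>x. x \<in> S \<Longrightarrow> (f has_derivative blinfun_apply (f' x)) (at x)" "continuous_on S f'"
    using assms(2) unfolding C1_on_def by blast
  obtain g' where g': "\<And>x. x \<in> T \<Longrightarrow> (g has_derivative blinfun_apply (g' x)) (at x)" "continuous_on T g'"
    using assms(1) unfolding C1_on_def by blast
  have "((\<lambda>x. g (f x)) has_derivative blinfun_apply (g' (f x) o\<^sub>L f' x)) (at x)" if "x \<in> S" for x
    using has_derivative_compose[OF f'(1)[OF that] g'(1)] assms(3) that
    by (auto simp: blinfun_compose.rep_eq o_def)
  moreover have "continuous_on S (\<lambda>x. g' (f x) o\<^sub>L f' x)"
    using continuous_on_compose2[OF g'(2) C1_on_continuous_on[OF assms(2)] assms(3)] f'(2)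
    by (intro continuous_intros)
  ultimately show ?thesis unfolding C1_on_def by (intro exI conjI ballI)
qed

lemma C1_on_bounded_linear: "bounded_linear f \<Longrightarrow> C1_on S f"
  unfolding C1_on_def
  by (intro exI[of _ "\<lambda>_. Blinfun f"])
     (auto simp: bounded_linear_Blinfun_apply intro: bounded_linear_imp_has_derivative)

lemma C1_on_bounded_linear_compose:
  "bounded_linear g \<Longrightarrow> C1_on S f \<Longrightarrow> C1_on S (\<lambda>x. g (f x))"
  by (rule C1_on_compose[OF C1_on_bounded_linear[of g UNIV]]) auto

lemmas C1_on_fst = C1_on_bounded_linear_compose[OF bounded_linear_fst]
  and C1_on_snd = C1_on_bounded_linear_compose[OF bounded_linear_snd]
  and C1_on_ident = C1_on_bounded_linear[OF bounded_linear_ident]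

lemma C1_on_const: "C1_on S (\<lambda>x. c)"
  unfolding C1_on_def by (intro exI[of _ "\<lambda>_. 0"]) (auto simp: zero_blinfun.rep_eq)

lemma C1_on_Pair:
  assumes "C1_on S f" "C1_on S g"
  shows "C1_on S (\<lambda>x. (f x, g x))"
proof -
  obtain f' where f': "\<And>x. x \<in> S \<Longrightarrow> (f has_derivative blinfun_apply (f' x)) (at x)" "continuous_on S f'"
    using assms(1) unfolding C1_on_def by blast
  obtain g' where g': "\<And>x. x \<in> S \<Longrightarrow> (g has_derivative blinfun_apply (g' x)) (at x)" "continuous_on S g'"
    using assms(2) unfolding C1_on_def by blast
  let ?l = "Blinfun (\<lambda>x. (x, 0)) :: 'b \<Rightarrow>\<^sub>L ('b \<times> 'c)" and ?r = "Blinfun (\<lambda>x. (0, x)) :: 'c \<Rightarrow>\<^sub>L ('b \<times> 'c)"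
  have l: "blinfun_apply ?l = (\<lambda>x. (x, 0))" and r: "blinfun_apply ?r = (\<lambda>x. (0, x))"
    by (intro bounded_linear_Blinfun_apply bounded_linear_Pair bounded_linear_zero bounded_linear_ident)+
  have "((\<lambda>x. (f x, g x)) has_derivative blinfun_apply ((?l o\<^sub>L f' x) + (?r o\<^sub>L g' x))) (at x)" if "x \<in> S" for x
    using has_derivative_Pair[OF f'(1)[OF that] g'(1)[OF that]]
    by (simp add: blinfun.add_left[abs_def] l r)
  moreover have "continuous_on S (\<lambda>x. (?l o\<^sub>L f' x) + (?r o\<^sub>L g' x))"
    using f'(2) g'(2) by (intro continuous_intros)
  ultimately show ?thesis unfolding C1_on_def by (intro exI conjI ballI)
qed

lemma C1_on_bounded_bilinear:
  fixes mul :: "'a::real_normed_vector \<Rightarrow> 'b::real_normed_vector \<Rightarrow> 'c::real_normed_vector"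
  assumes "bounded_bilinear mul" "C1_on S f" "C1_on S g"
  shows "C1_on S (\<lambda>x. mul (f x) (g x))"
proof -
  interpret bounded_bilinear mul by fact
  obtain f' where f': "\<And>x. x \<in> S \<Longrightarrow> (f has_derivative blinfun_apply (f' x)) (at x)" "continuous_on S f'"
    using assms(2) unfolding C1_on_def by blast
  obtain g' where g': "\<And>x. x \<in> S \<Longrightarrow> (g has_derivative blinfun_apply (g' x)) (at x)" "continuous_on S g'"
    using assms(3) unfolding C1_on_def by blast
  have "((\<lambda>x. mul (f x) (g x)) has_derivative
      blinfun_apply ((prod_right (f x) o\<^sub>L g' x) + (prod_left (g x) o\<^sub>L f' x))) (at x)" if "x \<in> S" for x
    using FDERIV[OF f'(1)[OF that] g'(1)[OF that]]
    by (simp add: blinfun.add_left[abs_def])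
  moreover have "continuous_on S (\<lambda>x. (prod_right (f x) o\<^sub>L g' x) + (prod_left (g x) o\<^sub>L f' x))"
    using f'(2) g'(2) assms(2,3)[THEN C1_on_continuous_on]
    by (intro continuous_intros bounded_linear.continuous_on[OF bounded_linear_prod_right]
        bounded_linear.continuous_on[OF bounded_linear_prod_left])
  ultimately show ?thesis unfolding C1_on_def by (intro exI conjI ballI)
qed

lemma C1_on_add: "C1_on S f \<Longrightarrow> C1_on S g \<Longrightarrow> C1_on S (\<lambda>x. f x + g x)"
  using C1_on_bounded_linear_compose[OF bounded_linear_add[OF bounded_linear_fst bounded_linear_snd], OF C1_on_Pair]
  by simp

text \<open>Differentiation under the integral sign is local and is carried out on a ball inside
  \<open>S\<close>, which is convex as the Leibniz rule requires. Continuity of the derivative is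
  that of an integral with a parameter.\<close>

lemma C1_on_integral:
  fixes H :: "'a::banach \<times> real \<Rightarrow> 'b::banach"
  assumes S: "open S" and H: "C1_on (S \<times> {a..b}) H"
  shows "C1_on S (\<lambda>x. integral {a..b} (\<lambda>t. H (x, t)))"
proof -
  obtain H' where H': "\<And>p. p \<in> S \<times> {a..b} \<Longrightarrow> (H has_derivative blinfun_apply (H' p)) (at p)"
    and cH': "continuous_on (S \<times> {a..b}) H'"
    using H unfolding C1_on_def by blast
  let ?l = "Blinfun (\<lambda>x. (x, 0)) :: 'a \<Rightarrow>\<^sub>L ('a \<times> real)"
  have l: "blinfun_apply ?l = (\<lambda>x. (x, 0))"
    by (intro bounded_linear_Blinfun_apply bounded_linear_Pair bounded_linear_zero bounded_linear_ident)
  have c: "continuous_on (S \<times> cbox a b) (\<lambda>(x, t). H' (x, t) o\<^sub>L ?l)"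
    using cH' by (auto simp: case_prod_beta' intro!: continuous_intros)
  have "((\<lambda>x. integral {a..b} (\<lambda>t. H (x, t))) has_derivative
      blinfun_apply (integral {a..b} (\<lambda>t. H' (x, t) o\<^sub>L ?l))) (at x)" if x: "x \<in> S" for x
  proof -
    obtain e where e: "e > 0" "ball x e \<subseteq> S" using S x openE by blast
    have "((\<lambda>x. integral (cbox a b) (\<lambda>t. H (x, t))) has_derivative
      blinfun_apply (integral (cbox a b) (\<lambda>t. H' (x, t) o\<^sub>L ?l))) (at x within ball x e)"
    proof (rule leibniz_rule)
      fix y t assume y: "y \<in> ball x e" "t \<in> cbox a b"
      have p: "((\<lambda>y. (y, t)) has_derivative (\<lambda>h. (h, 0))) (at y within ball x e)"
        by (auto intro!: derivative_eq_intros)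
      have "(H has_derivative blinfun_apply (H' (y, t))) (at (y, t))" using y e by (intro H') auto
      from has_derivative_compose[OF p this]
      show "((\<lambda>x. H (x, t)) has_derivative blinfun_apply (H' (y, t) o\<^sub>L ?l)) (at y within ball x e)"
        by (simp add: l blinfun_compose.rep_eq o_def)
    next
      fix y assume y: "y \<in> ball x e"
      show "(\<lambda>t. H (y, t)) integrable_on cbox a b"
        using y e by (intro integrable_continuous continuous_on_compose2[OF C1_on_continuous_on[OF H]] continuous_intros) auto
    next
      show "continuous_on (ball x e \<times> cbox a b) (\<lambda>(x, t). H' (x, t) o\<^sub>L ?l)"
        using c by (rule continuous_on_subset) (use e in auto)
    qed (use e in auto)
    then show ?thesis using e by (simp add: at_within_open[of x "ball x e"])
  qed
  moreover have "continuous_on S (\<lambda>x. integral {a..b} (\<lambda>t. H' (x, t) o\<^sub>L ?l))"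
    using integral_continuous_on_param[OF c] by simp
  ultimately show ?thesis unfolding C1_on_def by (intro exI conjI ballI)
qed

lemma C1_on_imp_C1_differentiable_on:
  assumes "C1_on S f"
  shows "f C1_differentiable_on S"
proof -
  obtain f' where f': "\<And>x. x \<in> S \<Longrightarrow> (f has_derivative blinfun_apply (f' x)) (at x)" "continuous_on S f'"
    using assms unfolding C1_on_def by blast
  have "blinfun_apply (f' x) = (\<lambda>h. h *\<^sub>R f' x 1)" for x
    by (simp flip: blinfun.scaleR_right)
  then have "(f has_vector_derivative f' x 1) (at x)" if "x \<in> S" for x
    using f'(1)[OF that] by (simp add: has_vector_derivative_def)
  moreover have "continuous_on S (\<lambda>x. f' x 1)" using f'(2) by (intro continuous_intros)
  ultimately show ?thesis
    unfolding C1_differentiable_on_def by (intro exI[of _ "\<lambda>x. f' x 1"] conjI ballI)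
qed

lemma C2_on_imp_C1_on: "C2_on S f \<Longrightarrow> C1_on S f"
  unfolding C2_on_def C1_on_def
  by (meson continuous_at_imp_continuous_on has_derivative_continuous)

text \<open>The partial derivative is the total derivative composed with the inclusion of the second
  factor, and the total derivative of a C2 map is C1.\<close>

lemma C1_on_D2:
  assumes "open I" "C2_on (I \<times> UNIV) F"
  shows "C1_on (I \<times> UNIV) (D2 F)"
proof -
  obtain F' F'' where F': "\<And>p. p \<in> I \<times> UNIV \<Longrightarrow> (F has_derivative blinfun_apply (F' p)) (at p)"
    and F'': "\<And>p. p \<in> I \<times> UNIV \<Longrightarrow> (F' has_derivative blinfun_apply (F'' p)) (at p)"
       "continuous_on (I \<times> UNIV) F''"
    using assms(2) unfolding C2_on_def by metis
  let ?r = "Blinfun (\<lambda>x. (0, x)) :: 'a \<Rightarrow>\<^sub>L (real \<times> 'a)"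
  have r: "blinfun_apply ?r = (\<lambda>x. (0, x))"
    by (intro bounded_linear_Blinfun_apply bounded_linear_Pair bounded_linear_zero bounded_linear_ident)
  have "C1_on (I \<times> UNIV) F'" using F'' unfolding C1_on_def by blast
  then have "C1_on (I \<times> UNIV) (\<lambda>p. F' p o\<^sub>L ?r)"
    by (intro C1_on_bounded_bilinear[OF bounded_bilinear_blinfun_compose] C1_on_const)
  moreover have "F' p o\<^sub>L ?r = D2 F p" if "p \<in> I \<times> UNIV" for p
  proof -
    obtain s x where p: "p = (s, x)" by force
    have "((\<lambda>y. (s, y)) has_derivative (\<lambda>h. (0, h))) (at x)"
      by (auto intro!: derivative_eq_intros)
    from has_derivative_compose[OF this F'[OF that, unfolded p]]
    have "((\<lambda>y. F (s, y)) has_derivative blinfun_apply (F' p o\<^sub>L ?r)) (at x)" by (simp add: p r blinfun_compose.rep_eq o_def)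
    with D2_has_derivative[OF assms(2), of s x] that
    have "blinfun_apply (F' p o\<^sub>L ?r) = blinfun_apply (D2 F p)"
      by (auto simp: p intro: has_derivative_unique)
    then show ?thesis by (simp add: blinfun_apply_inject)
  qed
  ultimately show ?thesis
    by (intro C1_on_cong[OF _ \<open>C1_on _ (\<lambda>p. F' p o\<^sub>L ?r)\<close>] open_Times assms) auto
qed

text \<open>The fundamental theorem of calculus on the segment from \<open>y\<close> to
  \<open>y + x\<close>. The operators are integrated before they are applied to \<open>x\<close>, so
  that a scalar factor of \<open>x\<close> can be taken out.\<close>

lemma D2_mean_value:
  fixes F :: "real \<times> 'a::banach \<Rightarrow> 'a"
  assumes "open I" "C2_on (I \<times> UNIV) F" "s \<in> I"
  shows "F (s, y + x) - F (s, y) = blinfun_apply (integral {0..1} (\<lambda>t. D2 F (s, y + t *\<^sub>R x))) x"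
proof -
  have "((\<lambda>t. F (s, y + t *\<^sub>R x)) has_vector_derivative D2 F (s, y + t *\<^sub>R x) x) (at t within {0..1})" for t
  proof -
    have "((\<lambda>t. y + t *\<^sub>R x) has_derivative (\<lambda>h. h *\<^sub>R x)) (at t within {0..1})"
      by (auto intro!: derivative_eq_intros)
    from has_derivative_compose[OF this D2_has_derivative[OF assms(2,3)]]
    show ?thesis by (simp add: has_vector_derivative_def blinfun.scaleR_right)
  qed
  then have "((\<lambda>t. D2 F (s, y + t *\<^sub>R x) x) has_integral F (s, y + 1 *\<^sub>R x) - F (s, y + 0 *\<^sub>R x)) {0..1}"
    by (intro fundamental_theorem_of_calculus) auto
  moreover have "(\<lambda>t. D2 F (s, y + t *\<^sub>R x)) integrable_on {0..1}"
    using assms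
    by (intro integrable_continuous_real continuous_on_compose2[OF C1_on_continuous_on[OF C1_on_D2[OF assms(1,2)]]] continuous_intros)
       auto
  then have "((\<lambda>t. D2 F (s, y + t *\<^sub>R x) x) has_integral integral {0..1} (\<lambda>t. D2 F (s, y + t *\<^sub>R x)) x) {0..1}"
    using has_integral_linear[OF integrable_integral blinfun.bounded_linear_left] by (simp add: o_def)
  ultimately show ?thesis by (simp add: has_integral_unique)
qed

section \<open>Bifurcation from the mother branch\<close>

lemma complement_in_subset:
  assumes "complement_in V Z W"
  shows "V \<subseteq> W" "Z \<subseteq> W"
proof -
  have V: "subspace V" "subspace Z" and W: "W = {v + z |v z. v \<in> V \<and> z \<in> Z}"
    using assms by (auto simp: complement_in_def)
  have "v + 0 \<in> W" if "v \<in> V" for v using that subspace_0[OF V(2)] unfolding W by blast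
  then show "V \<subseteq> W" by auto
  have "0 + z \<in> W" if "z \<in> Z" for z using that subspace_0[OF V(1)] unfolding W by blast
  then show "Z \<subseteq> W" by auto
qed

text \<open>\<open>T\<close> maps \<open>Z\<close> bijectively onto its range, because
  \<open>Z\<close> complements the kernel, and \<open>k\<close> spans what the range misses, because
  the range has codimension one. Hence \<open>k\<close> and the image of \<open>Z\<close> together
  fill \<open>W\<close> exactly once.\<close>

lemma bordered_operator:
  fixes T :: "'a::real_normed_vector \<Rightarrow>\<^sub>L 'a"
  assumes W: "subspace W" and TW: "\<And>w. w \<in> W \<Longrightarrow> blinfun_apply T w \<in> W"
    and null: "null_space_on W T = span {x0}" and codim: "codim_one_in (range_on W T) W"
    and k: "k \<in> W" "k \<notin> range_on W T" and Z: "complement_in (span {x0}) Z W"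
  shows "(\<lambda>(\<sigma>, z). \<sigma> *\<^sub>R k + blinfun_apply T z) ` (UNIV \<times> Z) = W"
    and "\<And>\<sigma> z. z \<in> Z \<Longrightarrow> \<sigma> *\<^sub>R k + blinfun_apply T z = 0 \<Longrightarrow> \<sigma> = 0 \<and> z = 0"
proof -
  have Zs: "subspace Z" "span {x0} \<inter> Z = {0}" and sum: "{v + z |v z. v \<in> span {x0} \<and> z \<in> Z} = W"
    using Z by (auto simp: complement_in_def)
  have ZW: "Z \<subseteq> W" by (rule complement_in_subset[OF Z])
  obtain C where C: "complement_in (range_on W T) C W" "dim C = 1"
    using codim by (auto simp: codim_one_in_def)
  then have Cs: "subspace C" "subspace (range_on W T)" "{v + z |v z. v \<in> range_on W T \<and> z \<in> C} = W"
    by (auto simp: complement_in_def)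
  obtain B where B: "B \<subseteq> C" "independent B" "C \<subseteq> span B" "card B = 1"
    using basis_exists[of C] C(2) by metis
  then obtain c where c: "B = {c}" using card_1_singletonE by metis
  have Wc: "\<exists>r\<in>range_on W T. \<exists>\<tau>. w = r + \<tau> *\<^sub>R c" if w: "w \<in> W" for w
  proof -
    have "w \<in> {v + z |v z. v \<in> range_on W T \<and> z \<in> C}" using w by (simp only: Cs(3))
    then obtain r u where "r \<in> range_on W T" "u \<in> C" "w = r + u" by blast
    moreover have "u \<in> span {c}" using \<open>u \<in> C\<close> B(3) c by auto
    ultimately show ?thesis by (auto simp: span_singleton)
  qed
  obtain rk \<tau>k where rk: "rk \<in> range_on W T" "k = rk + \<tau>k *\<^sub>R c" using Wc[OF k(1)] by blast
  have \<tau>k: "\<tau>k \<noteq> 0" using k(2) rk by auto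
  show "(\<lambda>(\<sigma>, z). \<sigma> *\<^sub>R k + blinfun_apply T z) ` (UNIV \<times> Z) = W" (is "?L = W")
  proof
    show "?L \<subseteq> W"
      using k ZW TW by (auto intro!: subspace_add[OF W] subspace_scale[OF W])
    show "W \<subseteq> ?L"
    proof
      fix w assume "w \<in> W"
      then obtain r \<tau> where r: "r \<in> range_on W T" "w = r + \<tau> *\<^sub>R c" using Wc by blast
      \<comment> \<open>Modulo the range both \<open>w\<close> and \<open>k\<close> are multiples of
        \<open>c\<close>, and the multiple for \<open>k\<close> is nonzero; subtracting the right
        multiple of \<open>k\<close> cancels \<open>c\<close>.\<close>
      have "w - (\<tau> / \<tau>k) *\<^sub>R k = r - (\<tau> / \<tau>k) *\<^sub>R rk"
        using \<tau>k by (simp add: r rk scaleR_add_right)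
      also have "\<dots> \<in> range_on W T"
        by (intro subspace_diff subspace_scale Cs r rk)
      finally obtain y where y: "y \<in> W" "w - (\<tau> / \<tau>k) *\<^sub>R k = T y" by (auto simp: range_on_def)
      obtain v z where vz: "v \<in> span {x0}" "z \<in> Z" "y = v + z" using y(1) sum by auto
      have "T v = 0" using vz(1) null by (auto simp: null_space_on_def)
      then have "w = (\<tau> / \<tau>k) *\<^sub>R k + T z" using y(2) vz(3) by (simp add: blinfun.add_right algebra_simps)
      then show "w \<in> ?L" using vz(2) by (auto intro!: image_eqI[of _ _ "(\<tau> / \<tau>k, z)"])
    qed
  qed
  show "\<sigma> = 0 \<and> z = 0" if "z \<in> Z" "\<sigma> *\<^sub>R k + T z = 0" for \<sigma> z
  proof -
    have "\<sigma> = 0"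
    proof (rule ccontr)
      assume "\<sigma> \<noteq> 0"
      moreover have "\<sigma> *\<^sub>R k = T (- z)" using that(2) by (simp add: blinfun.minus_right eq_neg_iff_add_eq_0)
      ultimately have "k = (1 / \<sigma>) *\<^sub>R T (- z)" by (metis divide_self_if scaleR_one scaleR_scaleR times_divide_eq_left mult_1)
      also have "\<dots> \<in> range_on W T"
        using that(1) ZW subspace_neg[OF W] by (intro subspace_scale[OF Cs(2)]) (auto simp: range_on_def)
      finally show False using k(2) by simp
    qed
    moreover from this have "z \<in> null_space_on W T" using that ZW by (auto simp: null_space_on_def)
    ultimately show ?thesis using null Zs(2) that(1) by blast
  qed
qed

section \<open>Curves through the crossing point\<close>

lemma has_vector_derivative_approx:
  assumes "(f has_vector_derivative v) (at t)" "e > 0"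
  obtains d where "d > 0"
    "\<And>s. \<bar>s - t\<bar> < d \<Longrightarrow> norm (f s - f t - (s - t) *\<^sub>R v) \<le> e * \<bar>s - t\<bar>"
  using assms unfolding has_vector_derivative_def has_derivative_at_alt real_norm_def by metis

text \<open>
  The hypothesis \<open>cone\<close> says that, off the graph of \<open>b\<close>, the curve stays in a region that touches the
  graph only at the crossing point. Hence the set \<open>D\<close> below, the part of the graph outside that
  region, is open in the parameter interval, and the tangent at \<open>t0\<close> decides on which side \<open>t0\<close> belongs.
\<close>

lemma curve_through_crossing:
  fixes \<gamma> :: "real \<Rightarrow> real \<times> 'a::real_normed_vector"
  assumes T: "open T" "connected T" "t0 \<in> T" and inj: "inj_on \<gamma> T"
    and \<gamma>: "\<And>t. t \<in> T \<Longrightarrow> (\<gamma> has_vector_derivative \<gamma>' t) (at t)" and nz: "\<gamma>' t0 \<noteq> 0"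
    and b: "continuous_on S b" "(b has_vector_derivative b') (at s0)" and S: "fst ` \<gamma> ` T \<subseteq> S"
    and base: "\<gamma> t0 = (s0, b s0)" and c: "c \<ge> 0"
    and cone: "\<And>t. t \<in> T \<Longrightarrow> snd (\<gamma> t) \<noteq> b (fst (\<gamma> t)) \<Longrightarrow>
         \<bar>fst (\<gamma> t) - s0\<bar> \<le> c * norm (snd (\<gamma> t) - b (fst (\<gamma> t)))"
  shows "(\<forall>t\<in>T. snd (\<gamma> t) = b (fst (\<gamma> t))) \<or> (\<forall>t\<in>T - {t0}. snd (\<gamma> t) \<noteq> b (fst (\<gamma> t)))"
proof -
  define u where "u t = fst (\<gamma> t)" for t
  define Y where "Y t = snd (\<gamma> t) - b (u t)" for t
  have c\<gamma>: "continuous_on T \<gamma>"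
    using has_vector_derivative_continuous[OF \<gamma>] by (intro continuous_at_imp_continuous_on) auto
  have cu: "continuous_on T u" unfolding u_def by (intro continuous_intros c\<gamma>)
  have cY: "continuous_on T Y"
    unfolding Y_def using S
    by (intro continuous_intros c\<gamma> continuous_on_compose2[OF b(1) cu]) (auto simp: u_def)
  have u0: "u t0 = s0" and Y0: "Y t0 = 0" using base by (auto simp: u_def Y_def)
  define N where "N = {t \<in> T. Y t \<noteq> 0}"
  define D where "D = {t \<in> T. \<bar>u t - s0\<bar> - c * norm (Y t) > 0}"
  have "open (Y -` (- {0}) \<inter> T)"
    using cY by (simp add: continuous_on_open_vimage[OF T(1)] open_Compl)
  moreover have "Y -` (- {0}) \<inter> T = N" by (auto simp: N_def)
  ultimately have oN: "open N" by simp
  have "continuous_on T (\<lambda>t. \<bar>u t - s0\<bar> - c * norm (Y t))" by (intro continuous_intros cu cY)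
  then have "open ((\<lambda>t. \<bar>u t - s0\<bar> - c * norm (Y t)) -` {0<..} \<inter> T)"
    by (simp add: continuous_on_open_vimage[OF T(1)])
  moreover have "(\<lambda>t. \<bar>u t - s0\<bar> - c * norm (Y t)) -` {0<..} \<inter> T = D" by (auto simp: D_def)
  ultimately have oD: "open D" by simp
  have DN: "D \<inter> N = {}" using cone by (force simp: D_def N_def Y_def u_def)
  have "t0 \<notin> D" "t0 \<notin> N" using c by (auto simp: D_def N_def u0 Y0)
  \<comment> \<open>A point of the curve on the graph with first coordinate \<open>s0\<close> is the
    crossing point itself, which by injectivity is reached only at \<open>t0\<close>.\<close>
  have "t \<in> D \<union> N" if "t \<in> T" "t \<noteq> t0" for t
  proof (cases "Y t = 0")
    case True
    have "u t \<noteq> s0"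
    proof
      assume "u t = s0"
      then have "\<gamma> t = \<gamma> t0" using True base by (auto simp: Y_def u_def prod_eq_iff)
      then show False using inj that T(3) by (auto dest: inj_onD)
    qed
    then show ?thesis using that True by (simp add: D_def)
  qed (use that in \<open>simp add: N_def\<close>)
  then have DNT: "T = insert t0 (D \<union> N)" using T(3) by (auto simp: D_def N_def)
  have du: "(u has_vector_derivative fst (\<gamma>' t0)) (at t0)"
    unfolding u_def by (rule bounded_linear.has_vector_derivative[OF bounded_linear_fst \<gamma>[OF T(3)]])
  \<comment> \<open>\<open>v\<close> is the velocity of the deviation \<open>Y\<close> from the
    graph; it vanishes exactly when the curve is tangent to the graph at the crossing.\<close>
  define v where "v = snd (\<gamma>' t0) - fst (\<gamma>' t0) *\<^sub>R b'"
  have dY: "(Y has_vector_derivative v) (at t0)"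
  proof -
    have "((b \<circ> u) has_vector_derivative fst (\<gamma>' t0) *\<^sub>R b') (at t0)"
      using b(2) by (intro vector_diff_chain_at du) (simp add: u0)
    then show ?thesis
      unfolding Y_def v_def o_def
      by (intro has_vector_derivative_diff bounded_linear.has_vector_derivative[OF bounded_linear_snd \<gamma>[OF T(3)]])
  qed
  have ins: "open (insert t0 E)" if E: "open E" "\<exists>d>0. \<forall>t. \<bar>t - t0\<bar> < d \<longrightarrow> t \<noteq> t0 \<longrightarrow> t \<in> E" for E
  proof -
    obtain d where d: "d > 0" "\<And>t. \<bar>t - t0\<bar> < d \<Longrightarrow> t \<noteq> t0 \<Longrightarrow> t \<in> E" using E(2) by blast
    have "insert t0 E = E \<union> ball t0 d"
      using d by (force simp: dist_real_def abs_minus_commute)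
    then show ?thesis using E(1) by auto
  qed
  obtain dT where dT: "dT > 0" "\<And>t. \<bar>t - t0\<bar> < dT \<Longrightarrow> t \<in> T"
    using T(1,3) unfolding open_dist dist_real_def by metis
  show ?thesis
  proof (cases "v = 0")
    case True
    \<comment> \<open>With \<open>v = 0\<close> the tangent is a multiple of the graph's tangent, so
      a vanishing first component would make all of it vanish.\<close>
    define m where "m = \<bar>fst (\<gamma>' t0)\<bar>"
    have m: "m > 0" using True nz by (auto simp: m_def v_def prod_eq_iff)
    obtain d1 where d1: "d1 > 0" "\<And>t. \<bar>t - t0\<bar> < d1 \<Longrightarrow> \<bar>u t - s0 - (t - t0) * fst (\<gamma>' t0)\<bar> \<le> m / 2 * \<bar>t - t0\<bar>"
      using has_vector_derivative_approx[OF du, of "m / 2"] m by (auto simp: u0)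
    \<comment> \<open>Near \<open>t0\<close> this makes \<open>c * norm (Y t)\<close> at most m/4
      times \<bar>t - t0\<bar>, while \<bar>u t - s0\<bar> is at least m/2 times it, so the curve is
      outside the cone. The summand 1 covers \<open>c = 0\<close>.\<close>
    have "m / (4 * (c + 1)) > 0" using m c by auto
    then obtain d2 where d2: "d2 > 0" "\<And>t. \<bar>t - t0\<bar> < d2 \<Longrightarrow> norm (Y t) \<le> m / (4 * (c + 1)) * \<bar>t - t0\<bar>"
      using has_vector_derivative_approx[OF dY] unfolding Y0 True by (metis diff_zero scaleR_zero_right)
    have "t \<in> D" if "\<bar>t - t0\<bar> < min dT (min d1 d2)" "t \<noteq> t0" for t
    proof -
      have "m * \<bar>t - t0\<bar> - \<bar>u t - s0\<bar> \<le> m / 2 * \<bar>t - t0\<bar>"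
        using d1(2)[of t] that norm_triangle_ineq2[of "(t - t0) * fst (\<gamma>' t0)" "u t - s0"]
        by (simp add: abs_mult m_def abs_minus_commute mult.commute)
      moreover have "c * norm (Y t) \<le> c * (m / (4 * (c + 1)) * \<bar>t - t0\<bar>)"
        using d2(2)[of t] that c by (intro mult_left_mono) auto
      moreover have "c * (m / (4 * (c + 1)) * \<bar>t - t0\<bar>) \<le> m / 4 * \<bar>t - t0\<bar>"
      proof -
        have "c / (c + 1) \<le> 1" using c by simp
        then have "c / (c + 1) * (m / 4 * \<bar>t - t0\<bar>) \<le> 1 * (m / 4 * \<bar>t - t0\<bar>)"
          using m by (intro mult_right_mono) auto
        then show ?thesis by (simp add: field_simps)
      qed
      moreover have "m * \<bar>t - t0\<bar> > 0" using m that by simp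
      ultimately have "c * norm (Y t) < \<bar>u t - s0\<bar>" by linarith
      then show ?thesis using dT(2)[of t] that by (simp add: D_def)
    qed
    then have "open (insert t0 D)" by (intro ins oD exI[of _ "min dT (min d1 d2)"]) (use dT d1 d2 in auto)
    \<comment> \<open>\<open>T\<close> is now the disjoint union of the open sets
      \<open>insert t0 D\<close> and \<open>N\<close>; it is connected and contains
      \<open>t0\<close>, so \<open>N\<close> is empty.\<close>
    then have "insert t0 D \<inter> T = {} \<or> N \<inter> T = {}"
      using DN \<open>t0 \<notin> N\<close> DNT by (intro connectedD[OF T(2) _ oN]) auto
    then have "N = {}" using T(3) by (auto simp: N_def)
    then show ?thesis by (auto simp: N_def Y_def u_def)
  next
    case False
    then have "norm v / 2 > 0" by simp
    then obtain d1 where d1: "d1 > 0" "\<And>t. \<bar>t - t0\<bar> < d1 \<Longrightarrow> norm (Y t - (t - t0) *\<^sub>R v) \<le> norm v / 2 * \<bar>t - t0\<bar>"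
      using has_vector_derivative_approx[OF dY] unfolding Y0 by (metis diff_zero)
    have "t \<in> N" if "\<bar>t - t0\<bar> < min dT d1" "t \<noteq> t0" for t
    proof -
      have "Y t \<noteq> 0"
      proof
        assume "Y t = 0"
        then have "norm v * \<bar>t - t0\<bar> \<le> norm v / 2 * \<bar>t - t0\<bar>" using d1(2)[of t] that by (simp add: mult.commute)
        moreover have "norm v * \<bar>t - t0\<bar> > 0" using False that by simp
        ultimately show False by simp
      qed
      then show ?thesis using dT(2)[of t] that by (simp add: N_def)
    qed
    then have "open (insert t0 N)" by (intro ins oN exI[of _ "min dT d1"]) (use dT d1 in auto)
    then have "insert t0 N \<inter> T = {} \<or> D \<inter> T = {}"
      using DN \<open>t0 \<notin> D\<close> DNT by (intro connectedD[OF T(2) _ oD]) auto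
    then have "D = {}" using T(3) by (auto simp: D_def)
    then have "T - {t0} \<subseteq> N" using DNT by auto
    then show ?thesis by (auto simp: N_def Y_def u_def)
  qed
qed

section \<open>The daughter branch and the zeros near the bifurcation point\<close>

text \<open>The implicit function of the rescaled equation supplies the curve, and a norm estimate
  shows that it catches every zero in an open \<open>V\<close> off the graph of \<open>b\<close>.
  The bound with \<open>L\<close> is part of the conclusion because it later confines the daughter
  branch to a cone around the crossing.\<close>

lemma local_bifurcation:
  fixes F :: "real \<times> 'x::banach \<Rightarrow> 'x"
  assumes I: "open I" and F: "C2_on (I \<times> UNIV) F"
    and Im: "open I_m" "I_m \<subseteq> I" "s0 \<in> I_m"
    and b: "C1_on I_m b" "b ` I_m \<subseteq> W" and Fb: "\<And>s. s \<in> I_m \<Longrightarrow> F (s, b s) = 0"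
    and W: "F_invariant I F W" "closed W"
    and null: "null_space_on W (J F b s0) = span {x0}" and x0: "x0 \<noteq> 0"
    and codim: "codim_one_in (range_on W (J F b s0)) W"
    and trans: "blinfun_apply (J' F b s0) x0 \<notin> range_on W (J F b s0)"
    and Z: "complement_in (span {x0}) Z W" "closed Z"
  obtains a L \<phi> \<phi>' \<psi> \<psi>' V where
    "\<And>\<alpha>. \<bar>\<alpha>\<bar> < a \<Longrightarrow> (\<phi> has_vector_derivative \<phi>' \<alpha>) (at \<alpha>)" "continuous_on {-a<..<a} \<phi>'"
    "\<And>\<alpha>. \<bar>\<alpha>\<bar> < a \<Longrightarrow> (\<psi> has_vector_derivative \<psi>' \<alpha>) (at \<alpha>)" "continuous_on {-a<..<a} \<psi>'"
    "\<And>\<alpha>. \<bar>\<alpha>\<bar> < a \<Longrightarrow> \<bar>\<phi> \<alpha> - s0\<bar> \<le> L * \<bar>\<alpha>\<bar>"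
    "a > 0" "\<phi> 0 = s0" "\<psi> 0 = 0"
    "\<And>\<alpha>. \<bar>\<alpha>\<bar> < a \<Longrightarrow> \<phi> \<alpha> \<in> I_m \<and> \<psi> \<alpha> \<in> Z \<and> F (\<phi> \<alpha>, b (\<phi> \<alpha>) + \<alpha> *\<^sub>R (x0 + \<psi> \<alpha>)) = 0"
    "open V" "(s0, b s0) \<in> V" "V \<subseteq> I_m \<times> UNIV"
    "\<And>s x. (s, x) \<in> V \<Longrightarrow> x \<in> W \<Longrightarrow> F (s, x) = 0 \<Longrightarrow>
       x = b s \<or> (\<exists>\<alpha>. \<bar>\<alpha>\<bar> < a \<and> s = \<phi> \<alpha> \<and> x = b s + \<alpha> *\<^sub>R (x0 + \<psi> \<alpha>))"
proof -
  have Ws: "subspace W" using W by (simp add: F_invariant_def)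
  have Zs: "subspace Z" "span {x0} \<inter> Z = {0}" and sum: "{v + z |v z. v \<in> span {x0} \<and> z \<in> Z} = W"
    using Z by (auto simp: complement_in_def)
  have ZW: "z \<in> W" if "z \<in> Z" for z using complement_in_subset(2)[OF Z(1)] that by blast
  have x0W: "x0 \<in> W" using complement_in_subset(1)[OF Z(1)] span_base[of x0 "{x0}"] by blast
  have D2: "C1_on (I \<times> UNIV) (D2 F)" by (rule C1_on_D2[OF I F])
  have bW: "b s \<in> W" if "s \<in> I_m" for s using b(2) that by blast
  define T where "T = J F b s0"
  define k where "k = J' F b s0 x0"
  \<comment> \<open>\<open>J'\<close> is given by \<open>vector_derivative\<close>, so
    \<open>J F b\<close> has to be shown differentiable before condition (b) can be used as a
    statement about a derivative.\<close>
  have J: "C1_on I_m (J F b)"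
    unfolding J_def[abs_def]
    using Im by (intro C1_on_compose[OF D2] C1_on_Pair b(1) C1_on_bounded_linear bounded_linear_ident) auto
  then obtain dJ where "(J F b has_derivative blinfun_apply (dJ s0)) (at s0)"
    unfolding C1_on_def using Im by blast
  then have dJ: "(J F b has_vector_derivative J' F b s0) (at s0)"
    unfolding J'_def by (intro vector_derivative_works[THEN iffD1] differentiableI)
  have JW: "J F b s w \<in> W" if "s \<in> I_m" "w \<in> W" for s w
    unfolding J_def using that Im bW by (intro D2_invariant[OF F _ W]) auto
  have kW: "k \<in> W"
  proof (rule vector_derivative_in_closed_subspace[OF _ Ws W(2) Im(1,3)])
    show "((\<lambda>s. J F b s x0) has_vector_derivative k) (at s0)"
      unfolding k_def by (rule bounded_linear.has_vector_derivative[OF blinfun.bounded_linear_left dJ])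
  qed (use JW x0W in auto)
  have TW: "T w \<in> W" if "w \<in> W" for w using JW Im that by (simp add: T_def)
  note bord = bordered_operator[OF Ws TW null[folded T_def] codim[folded T_def] kW trans[folded T_def k_def] Z(1)]
  define Y where "Y = (UNIV :: real set) \<times> Z"
  have Ys: "subspace Y" "closed Y"
    unfolding Y_def using Zs(1) Z(2) by (auto intro: subspace_Times closed_Times)
  define M where "M p = integral {0..1} (\<lambda>t. D2 F (fst p, b (fst p) + t *\<^sub>R snd p))" for p
  have M: "C1_on (I_m \<times> UNIV) M"
  proof -
    define H where "H q = D2 F (fst (fst q), b (fst (fst q)) + snd q *\<^sub>R snd (fst q))"
      for q :: "(real \<times> 'x) \<times> real"
    have "C1_on ((I_m \<times> UNIV) \<times> {0..1}) (\<lambda>q. fst (fst q))"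
      by (intro C1_on_fst C1_on_ident)
    then have "C1_on ((I_m \<times> UNIV) \<times> {0..1}) (\<lambda>q. b (fst (fst q)))"
      by (rule C1_on_compose[OF b(1)]) auto
    then have "C1_on ((I_m \<times> UNIV) \<times> {0..1})
        (\<lambda>q. (fst (fst q), b (fst (fst q)) + snd q *\<^sub>R snd (fst q)))"
      by (intro C1_on_Pair C1_on_add C1_on_fst C1_on_snd C1_on_ident
          C1_on_bounded_bilinear[OF bounded_bilinear_scaleR])
    then have "C1_on ((I_m \<times> UNIV) \<times> {0..1}) H"
      unfolding H_def using Im by (intro C1_on_compose[OF D2]) auto
    then show ?thesis
      unfolding M_def using C1_on_integral[of "I_m \<times> UNIV" 0 1 H] Im by (simp add: H_def open_Times)
  qed
  have M0: "M (s, 0) = J F b s" for s by (simp add: M_def J_def)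
  have MF: "M (s, y) y = F (s, b s + y)" if "s \<in> I_m" for s y
    using D2_mean_value[OF I F, of s "b s" y] that Im Fb[OF that] by (auto simp: M_def)
  define \<Omega> where "\<Omega> = (UNIV :: real set) \<times> (I_m \<times> (UNIV :: 'x set))"
  \<comment> \<open>Extends \<open>F (s, b s + \<alpha> *\<^sub>R (x0 + z)) /\<^sub>R \<alpha>\<close> to \<open>\<alpha> = 0\<close>; the arguments are \<open>(\<alpha>, s, z)\<close>.\<close>
  define G where "G q = M (fst (snd q), fst q *\<^sub>R (x0 + snd (snd q))) (x0 + snd (snd q))" for q
  have G: "C1_on \<Omega> G"
  proof -
    have w: "C1_on \<Omega> (\<lambda>q. x0 + snd (snd q))"
      by (intro C1_on_add C1_on_const C1_on_snd C1_on_ident)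
    then have "C1_on \<Omega> (\<lambda>q. (fst (snd q), fst q *\<^sub>R (x0 + snd (snd q))))"
      by (intro C1_on_Pair C1_on_bounded_bilinear[OF bounded_bilinear_scaleR] C1_on_fst C1_on_snd C1_on_ident)
    then have "C1_on \<Omega> (\<lambda>q. M (fst (snd q), fst q *\<^sub>R (x0 + snd (snd q))))"
      by (rule C1_on_compose[OF M]) (auto simp: \<Omega>_def)
    with w show ?thesis
      unfolding G_def by (intro C1_on_bounded_bilinear[OF bounded_bilinear_blinfun_apply])
  qed
  then obtain G' where dG: "\<And>q. q \<in> \<Omega> \<Longrightarrow> (G has_derivative blinfun_apply (G' q)) (at q)"
    and cG': "continuous_on \<Omega> G'" unfolding C1_on_def by blast
  let ?base = "(0, s0, 0) :: real \<times> real \<times> 'x"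
  have base: "?base \<in> \<Omega>" using Im by (simp add: \<Omega>_def)
  \<comment> \<open>The derivative is computed along a line with amplitude 0, where \<open>G\<close>
    reduces to \<open>J F b s\<close> applied to \<open>x0 + z\<close>; the product rule then gives
    one term for each factor.\<close>
  have G'0: "G' ?base (0, \<sigma>, z) = \<sigma> *\<^sub>R k + T z" for \<sigma> z
  proof (rule vector_derivative_unique_at)
    have "((\<lambda>h. (0, s0 + h * \<sigma>, h *\<^sub>R z)) has_derivative (\<lambda>h. h *\<^sub>R (0, \<sigma>, z))) (at (0::real))"
      by (auto intro!: derivative_eq_intros)
    from has_derivative_compose[OF this, of G "G' ?base"]
    show "((\<lambda>h. G (0, s0 + h * \<sigma>, h *\<^sub>R z)) has_vector_derivative G' ?base (0, \<sigma>, z)) (at 0)"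
      using dG[OF base] by (simp add: has_vector_derivative_def flip: blinfun.scaleR_right)
    have 1: "((\<lambda>h. s0 + h * \<sigma>) has_vector_derivative \<sigma>) (at 0)"
      by (auto intro!: derivative_eq_intros simp: has_vector_derivative_def)
    have "((J F b \<circ> (\<lambda>h. s0 + h * \<sigma>)) has_vector_derivative \<sigma> *\<^sub>R J' F b s0) (at 0)"
      using dJ by (intro vector_diff_chain_at 1) simp
    moreover have "((\<lambda>h. x0 + h *\<^sub>R z) has_vector_derivative z) (at 0)"
      by (auto intro!: derivative_eq_intros simp: has_vector_derivative_def)
    ultimately have "((\<lambda>h. (J F b \<circ> (\<lambda>h. s0 + h * \<sigma>)) h (x0 + h *\<^sub>R z)) has_vector_derivative
       (J F b \<circ> (\<lambda>h. s0 + h * \<sigma>)) 0 z + (\<sigma> *\<^sub>R J' F b s0) (x0 + 0 *\<^sub>R z)) (at 0)"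
      by (rule bounded_bilinear.has_vector_derivative[OF bounded_bilinear_blinfun_apply])
    then show "((\<lambda>h. G (0, s0 + h * \<sigma>, h *\<^sub>R z)) has_vector_derivative \<sigma> *\<^sub>R k + T z) (at 0)"
      by (simp add: G_def M0 T_def k_def blinfun.scaleR_left add.commute)
  qed
  \<comment> \<open>For nonzero amplitude \<open>G\<close> is a multiple of a value of
    \<open>F\<close>, for zero amplitude a value of the linearization; both stay in the invariant
    subspace.\<close>
  have GW: "G (\<alpha>, y) \<in> W" if "(\<alpha>, y) \<in> \<Omega>" "y \<in> Y" for \<alpha> y
  proof -
    obtain s z where y: "y = (s, z)" by force
    have sz: "s \<in> I_m" "z \<in> Z" using that by (auto simp: y \<Omega>_def Y_def)
    have w: "x0 + z \<in> W" using x0W ZW[OF sz(2)] by (rule subspace_add[OF Ws])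
    show ?thesis
    proof (cases "\<alpha> = 0")
      case True
      then show ?thesis using JW[OF sz(1) w] by (simp add: G_def y M0)
    next
      case False
      have "\<alpha> *\<^sub>R G (\<alpha>, y) = F (s, b s + \<alpha> *\<^sub>R (x0 + z))"
        using MF[OF sz(1), of "\<alpha> *\<^sub>R (x0 + z)"] by (simp add: G_def y blinfun.scaleR_right)
      moreover have "F (s, b s + \<alpha> *\<^sub>R (x0 + z)) \<in> W"
        using W(1) sz Im w bW[OF sz(1)] by (auto simp: F_invariant_def subspace_add subspace_scale)
      ultimately have "(1 / \<alpha>) *\<^sub>R (\<alpha> *\<^sub>R G (\<alpha>, y)) \<in> W" using subspace_scale[OF Ws] by metis
      then show ?thesis using False by simp
    qed
  qed
  have T0: "T x0 = 0" using null span_base[of x0 "{x0}"] by (auto simp: null_space_on_def T_def)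
  have G0: "G ?base = 0" by (simp add: G_def M0 T0[unfolded T_def])
  define A where "A = G' ?base o\<^sub>L Blinfun (\<lambda>y. (0, y))"
  have "bounded_linear (\<lambda>y :: real \<times> 'x. (0 :: real, y))"
    by (intro bounded_linear_Pair bounded_linear_zero bounded_linear_ident)
  then have A: "A y = G' ?base (0, y)" for y by (simp add: A_def bounded_linear_Blinfun_apply)
  have imA: "blinfun_apply A ` Y = W"
    using bord(1) by (simp add: A[abs_def] G'0 Y_def case_prod_unfold image_def)
  obtain C where C: "C > 0" "\<And>w. w \<in> W \<Longrightarrow> \<exists>y\<in>Y. A y = w \<and> norm y \<le> C * norm w"
    using open_mapping_closed_subspace[OF Ys W(2) imA] by blast
  \<comment> \<open>Open mapping gives some preimage with a norm bound, and injectivity on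
    \<open>Y\<close> identifies it with \<open>y\<close>.\<close>
  have CA: "norm y \<le> C * norm (G' ?base (0, y))" if y: "y \<in> Y" for y
  proof -
    obtain y' where y': "y' \<in> Y" "A y' = A y" "norm y' \<le> C * norm (A y)" using C(2)[of "A y"] imA y by blast
    have "A (y - y') = 0" using y' by (simp add: blinfun.diff_right)
    moreover have "y - y' \<in> Y" by (rule subspace_diff[OF Ys(1) y y'(1)])
    ultimately have "y - y' = 0"
      using bord(2)[of "snd (y - y')" "fst (y - y')"] G'0[of "fst (y - y')" "snd (y - y')"]
      by (auto simp: A Y_def prod_eq_iff)
    then show ?thesis using y'(3) by (simp add: A)
  qed
  have surj: "(\<lambda>y. G' ?base (0, y)) ` Y = W" using imA by (simp add: A[abs_def])
  have oO: "open \<Omega>" unfolding \<Omega>_def using Im by (intro open_Times) auto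
  have y0: "(s0, 0) \<in> Y" using subspace_0[OF Zs(1)] by (simp add: Y_def)
  obtain a r L g g' where dg: "\<And>t. \<bar>t - 0\<bar> < a \<Longrightarrow> (g has_vector_derivative g' t) (at t)"
    and cg': "continuous_on {0 - a<..<0 + a} g'"
    and gL: "\<And>s t. \<bar>s - 0\<bar> < a \<Longrightarrow> \<bar>t - 0\<bar> < a \<Longrightarrow> norm (g s - g t) \<le> L * \<bar>s - t\<bar>"
    and a: "a > 0" and g0: "g 0 = (s0, 0)"
    and g: "\<And>t. \<bar>t - 0\<bar> < a \<Longrightarrow> (t, g t) \<in> \<Omega> \<and> g t \<in> Y \<and> G (t, g t) = 0"
    and guniq: "\<And>t y. \<bar>t - 0\<bar> < a \<Longrightarrow> y \<in> Y \<Longrightarrow> norm (y - (s0, 0)) \<le> r \<Longrightarrow> G (t, y) = 0 \<Longrightarrow> y = g t"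
    and r: "r > 0"
    by (rule implicit_function_closed_subspace[OF Ys Ws W(2) oO base y0 dG cG' GW G0 surj C(1) CA],
        assumption+, rule that, assumption+)
  define \<phi> where "\<phi> t = fst (g t)" for t
  define \<psi> where "\<psi> t = snd (g t)" for t
  \<comment> \<open>\<epsilon> bounds the distance of \<open>M (s, y)\<close> from \<open>T\<close>.
    The first entry makes the \<open>Z\<close>-part of a zero at most half of the zero, so that the
    zero is comparable to its part along \<open>x0\<close>; the second puts the
    \<open>Z\<close>-part, divided by the amplitude, into the ball of radius
    \<open>r / 2\<close>.\<close>
  define \<epsilon> where "\<epsilon> = min (1 / (2 * C)) (r / (4 * C * (norm x0 + 1)))"
  have \<epsilon>: "\<epsilon> > 0" "C * \<epsilon> \<le> 1 / 2" "2 * (C * \<epsilon>) * norm x0 \<le> r / 2"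
  proof -
    show "\<epsilon> > 0" using C(1) r by (simp add: \<epsilon>_def add_nonneg_pos)
    have "C * \<epsilon> \<le> C * (1 / (2 * C))" using C(1) by (intro mult_left_mono) (auto simp: \<epsilon>_def)
    then show "C * \<epsilon> \<le> 1 / 2" using C(1) by simp
    have K: "C * (r / (4 * C * K)) * (4 * K) = r" if "K > 0" for K
      using C(1) that by simp
    have "C * \<epsilon> * (4 * (norm x0 + 1)) \<le> C * (r / (4 * C * (norm x0 + 1))) * (4 * (norm x0 + 1))"
      using C(1) by (intro mult_right_mono mult_left_mono) (auto simp: \<epsilon>_def)
    also have "\<dots> = r" by (rule K) (simp add: add_nonneg_pos)
    finally show "2 * (C * \<epsilon>) * norm x0 \<le> r / 2" using C(1) \<open>\<epsilon> > 0\<close> by (simp add: algebra_simps)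
        (smt (verit) mult_pos_pos)
  qed
  have "isCont M (s0, 0)"
    using C1_on_continuous_on[OF M] Im by (simp add: continuous_on_eq_continuous_at open_Times)
  then obtain d where d: "d > 0" "\<And>p. dist p (s0, 0) < d \<Longrightarrow> dist (M p) (M (s0, 0)) < \<epsilon>"
    using \<epsilon>(1) unfolding continuous_at_eps_delta by blast
  obtain e where e: "e > 0" "ball s0 e \<subseteq> I_m" using Im openE by blast
  \<comment> \<open>The entries ensure, in turn, that \<open>M (s, y)\<close> is \<epsilon>-close to
    \<open>T\<close>, that \<open>s\<close> uses at most half of the uniqueness radius, that
    \<open>s\<close> lies in \<open>I_m\<close>, and that the amplitude is smaller than
    \<open>a\<close>.\<close>
  define \<delta> where "\<delta> = min (d / 2) (min (r / 2) (min e (a * norm x0 / 2)))"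
  have \<delta>: "\<delta> > 0" using d r e a x0 by (simp add: \<delta>_def)
  define V where "V = (\<lambda>p. snd p - b (fst p)) -` ball 0 \<delta> \<inter> (ball s0 \<delta> \<times> UNIV)"
  have bI: "ball s0 \<delta> \<subseteq> I_m" using e by (auto simp: \<delta>_def)
  \<comment> \<open>A zero \<open>y = \<alpha> *\<^sub>R x0 + z\<close> of \<open>M (s, y)\<close> satisfies \<open>T z = (T - M (s, y)) y\<close> and \<open>T\<close> is bounded
    below on \<open>Z\<close>, so \<open>z\<close> is small relative to \<open>\<alpha>\<close> and the uniqueness of \<open>g\<close> applies to \<open>z /\<^sub>R \<alpha>\<close>.\<close>
  have Vzero: "x = b s \<or> (\<exists>\<alpha>. \<bar>\<alpha>\<bar> < a \<and> s = \<phi> \<alpha> \<and> x = b s + \<alpha> *\<^sub>R (x0 + \<psi> \<alpha>))"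
    if V: "(s, x) \<in> V" and xW: "x \<in> W" and F0: "F (s, x) = 0" for s x
  proof (cases "x = b s")
    case False
    define y where "y = x - b s"
    have s: "\<bar>s - s0\<bar> < \<delta>" "s \<in> I_m" and yn: "norm y < \<delta>" and ynz: "y \<noteq> 0"
      using V bI False by (auto simp: V_def y_def dist_real_def abs_minus_commute)
    have "y \<in> W" unfolding y_def by (intro subspace_diff Ws xW bW s)
    then obtain v z where vz: "v \<in> span {x0}" "z \<in> Z" "y = v + z" unfolding sum[symmetric] by blast
    then obtain \<alpha> where \<alpha>: "y = \<alpha> *\<^sub>R x0 + z" by (auto simp: span_singleton)
    have My: "M (s, y) y = 0" using MF[OF s(2), of y] F0 by (simp add: y_def)
    have "dist (s, y) (s0, 0) < d"
      using norm_Pair_le[of "s - s0" y] s yn by (simp add: dist_norm \<delta>_def)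
    then have MT: "norm (T - M (s, y)) \<le> \<epsilon>"
      using d(2)[of "(s, y)"] by (simp add: dist_norm M0 T_def norm_minus_commute)
    have "T y = T z" by (simp add: \<alpha> blinfun.add_right blinfun.scaleR_right T0)
    have "norm z \<le> C * norm (T z)"
      using CA[of "(0, z)"] vz(2) by (simp add: G'0 Y_def norm_Pair)
    also have "T z = (T - M (s, y)) y" using \<open>T y = T z\<close> My by (simp add: blinfun.diff_left)
    also have "norm ((T - M (s, y)) y) \<le> \<epsilon> * norm y"
      using norm_blinfun[of "T - M (s, y)" y] mult_right_mono[OF MT, of "norm y"] by simp
    finally have zn: "norm z \<le> C * \<epsilon> * norm y" using C(1) by (simp add: mult.assoc)
    then have zn2: "norm z \<le> norm y / 2"
      using mult_right_mono[OF \<epsilon>(2), of "norm y"] by simp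
    have "norm y \<le> \<bar>\<alpha>\<bar> * norm x0 + norm z" using norm_triangle_ineq[of "\<alpha> *\<^sub>R x0" z] by (simp add: \<alpha>)
    then have y\<alpha>: "norm y \<le> 2 * (\<bar>\<alpha>\<bar> * norm x0)" using zn2 by simp
    then have \<alpha>0: "\<alpha> \<noteq> 0" using ynz by auto
    have "\<bar>\<alpha>\<bar> * norm x0 \<le> norm y + norm z" using norm_triangle_ineq4[of y z] by (simp add: \<alpha>)
    also have "\<dots> < a * norm x0"
    proof -
      have "2 * norm y < a * norm x0" using yn by (simp add: \<delta>_def)
      then show ?thesis using zn2 norm_ge_zero[of y] by linarith
    qed
    finally have \<alpha>a: "\<bar>\<alpha>\<bar> < a" using x0 by simp
    define \<zeta> where "\<zeta> = (1 / \<alpha>) *\<^sub>R z"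
    have z\<zeta>: "z = \<alpha> *\<^sub>R \<zeta>" using \<alpha>0 by (simp add: \<zeta>_def)
    have "norm z \<le> C * \<epsilon> * (2 * (\<bar>\<alpha>\<bar> * norm x0))"
      using order_trans[OF zn mult_left_mono[OF y\<alpha>, of "C * \<epsilon>"]] C(1) \<epsilon>(1) by simp
    also have "\<dots> = \<bar>\<alpha>\<bar> * (2 * (C * \<epsilon>) * norm x0)" by simp
    also have "\<dots> \<le> \<bar>\<alpha>\<bar> * (r / 2)" using \<epsilon>(3) by (intro mult_left_mono) auto
    finally have "norm \<zeta> \<le> r / 2" using \<alpha>0 by (simp add: z\<zeta>)
    then have "norm ((s, \<zeta>) - (s0, 0)) \<le> r"
      using norm_Pair_le[of "s - s0" \<zeta>] s by (simp add: \<delta>_def)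
    moreover have "(s, \<zeta>) \<in> Y" using subspace_scale[OF Zs(1) vz(2)] by (simp add: Y_def \<zeta>_def)
    moreover have y\<zeta>: "y = \<alpha> *\<^sub>R (x0 + \<zeta>)" by (simp add: \<alpha> z\<zeta> scaleR_add_right)
    moreover have "\<alpha> *\<^sub>R G (\<alpha>, s, \<zeta>) = 0"
      using My by (simp add: G_def y\<zeta> blinfun.scaleR_right)
    ultimately have "(s, \<zeta>) = g \<alpha>" using \<alpha>0 \<alpha>a by (intro guniq) auto
    then have "s = \<phi> \<alpha>" "\<zeta> = \<psi> \<alpha>" by (auto simp: \<phi>_def \<psi>_def dest: arg_cong[of _ _ fst] arg_cong[of _ _ snd])
    then show ?thesis using \<alpha>a y\<zeta> by (auto simp: y_def algebra_simps)
  qed simp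
  show thesis
  proof (rule that[of a \<phi> "\<lambda>t. fst (g' t)" \<psi> "\<lambda>t. snd (g' t)" L V])
    show "a > 0" by (rule a)
    show "\<phi> 0 = s0" "\<psi> 0 = 0" by (simp_all add: \<phi>_def \<psi>_def g0)
    fix \<alpha> assume \<alpha>: "\<bar>\<alpha>\<bar> < a"
    then have h: "\<phi> \<alpha> \<in> I_m" "\<psi> \<alpha> \<in> Z" "G (\<alpha>, \<phi> \<alpha>, \<psi> \<alpha>) = 0"
      using g[of \<alpha>] by (auto simp: \<Omega>_def Y_def \<phi>_def \<psi>_def mem_Times_iff)
    then have "M (\<phi> \<alpha>, \<alpha> *\<^sub>R (x0 + \<psi> \<alpha>)) (\<alpha> *\<^sub>R (x0 + \<psi> \<alpha>)) = 0"
      by (simp add: G_def blinfun.scaleR_right)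
    then show "\<phi> \<alpha> \<in> I_m \<and> \<psi> \<alpha> \<in> Z \<and> F (\<phi> \<alpha>, b (\<phi> \<alpha>) + \<alpha> *\<^sub>R (x0 + \<psi> \<alpha>)) = 0"
      using h MF by simp
    show "(\<phi> has_vector_derivative fst (g' \<alpha>)) (at \<alpha>)" "(\<psi> has_vector_derivative snd (g' \<alpha>)) (at \<alpha>)"
      unfolding \<phi>_def \<psi>_def using dg[of \<alpha>] \<alpha>
      by (auto intro: bounded_linear.has_vector_derivative[OF bounded_linear_fst] bounded_linear.has_vector_derivative[OF bounded_linear_snd])
    have "norm (fst (g \<alpha> - g 0)) \<le> norm (g \<alpha> - g 0)"
      by (metis norm_fst_le prod.collapse)
    then have "\<bar>\<phi> \<alpha> - s0\<bar> \<le> norm (g \<alpha> - g 0)" by (simp add: \<phi>_def g0)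
    then show "\<bar>\<phi> \<alpha> - s0\<bar> \<le> L * \<bar>\<alpha>\<bar>" using gL[of \<alpha> 0] \<alpha> a by simp
  next
    show "continuous_on {-a<..<a} (\<lambda>t. fst (g' t))" "continuous_on {-a<..<a} (\<lambda>t. snd (g' t))"
      using cg' by (auto intro: continuous_on_fst continuous_on_snd)
    show "open V"
    proof -
      have "continuous_on (ball s0 \<delta> \<times> UNIV) (\<lambda>p. snd p - b (fst p))"
        using bI by (intro continuous_intros continuous_on_compose2[OF C1_on_continuous_on[OF b(1)]]) auto
      then show ?thesis
        unfolding V_def by (subst (asm) continuous_on_open_vimage) (auto simp: open_Times)
    qed
    show "(s0, b s0) \<in> V" using \<delta> by (simp add: V_def)
    show "V \<subseteq> I_m \<times> UNIV" using bI by (auto simp: V_def)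
  qed (rule Vzero)
qed

section \<open>Both branches and the exclusion of further ones\<close>

theorem theorem2p12:
  fixes I :: "real set"
    and F :: "real \<times> 'x::banach \<Rightarrow> 'x"
    and W_m W_d Z :: "'x set"
    and s_star :: real and x_star x0 :: 'x
    and I_m :: "real set" and b_m :: "real \<Rightarrow> 'x"
  assumes "open_interval I"
    and "C2_on (I \<times> UNIV) F"
    and "F_invariant I F W_m"
    and "(s_star, x_star) \<in> I \<times> W_m"
    and "F (s_star, x_star) = 0"
    and "nonsingular_on W_m (D2 F (s_star, x_star))"
    and "mother_branch_function I F W_m s_star x_star I_m b_m"
    and "F_invariant I F W_d" and "closed W_d"
    and "W_m \<subset> W_d"
    and a1: "dim (null_space_on W_d (J F b_m s_star)) = 1"
    and a2: "codim_one_in (range_on W_d (J F b_m s_star)) W_d"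
    and b1: "null_space_on W_d (J F b_m s_star) = span {x0}"
    and b2: "blinfun_apply (J' F b_m s_star) x0 \<notin> range_on W_d (J F b_m s_star)"
    and "complement_in (span {x0}) Z W_d" and "closed Z"
  shows "\<exists>U a \<phi> \<psi>.
      neighborhood_in (I \<times> UNIV) (s_star, x_star) U \<and>
      0 < a \<and>
      \<phi> C1_differentiable_on {-a<..<a} \<and> \<phi> ` {-a<..<a} \<subseteq> I_m \<and>
      \<psi> C1_differentiable_on {-a<..<a} \<and> \<psi> ` {-a<..<a} \<subseteq> Z \<and>
      \<phi> 0 = s_star \<and> \<psi> 0 = 0 \<and>
      (let C_m = mother_branch I_m b_m; C_d = daughter_branch b_m x0 a \<phi> \<psi> in
        {p. F p = 0} \<inter> (I \<times> W_d) \<inter> U = C_m \<union> C_d \<and>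
        C_m \<inter> C_d = {(s_star, x_star)} \<and>
        solution_branch I F C_m \<and> solution_branch I F C_d \<and>
        (\<forall>B. solution_branch I F B \<and> B \<subseteq> (I \<times> W_d) \<inter> U \<and> (s_star, x_star) \<in> B
              \<longrightarrow> B \<subseteq> C_m \<or> B \<subseteq> C_d))"
proof -
  have I: "open I" using assms(1) by (simp add: open_interval_def)
  have Im: "open I_m" "is_interval I_m" "s_star \<in> I_m" "I_m \<subseteq> I" "I_m \<noteq> {}"
    and bm: "b_m ` I_m \<subseteq> W_m" "C2_on I_m b_m" "b_m s_star = x_star"
    and mother: "\<exists>U0. {p. F p = 0} \<inter> (I \<times> W_m) \<inter> U0 = mother_branch I_m b_m"
    using assms(7) unfolding mother_branch_function_def open_interval_def by blast+
  have Fb: "F (s, b_m s) = 0" if "s \<in> I_m" for s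
    using mother that unfolding mother_branch_def by blast
  have bW: "b_m ` I_m \<subseteq> W_d" using bm(1) assms(10) by blast
  have b: "C1_on I_m b_m" by (rule C2_on_imp_C1_on[OF bm(2)])
  have x0: "x0 \<noteq> 0"
  proof
    assume "x0 = 0"
    then have "null_space_on W_d (J F b_m s_star) = span {}" using b1 by simp
    then show False
      using a1 dim_span[of "{} :: 'x set"] real_vector.dim_eq_card_independent[OF real_vector.independent_empty, where 'a = 'x]
      by simp
  qed
  have Wd: "subspace W_d" using assms(8) by (simp add: F_invariant_def)
  have Zs: "subspace Z" "span {x0} \<inter> Z = {0}" using assms(15) by (auto simp: complement_in_def)
  have ZW: "Z \<subseteq> W_d" by (rule complement_in_subset(2)[OF assms(15)])
  have x0W: "x0 \<in> W_d" using complement_in_subset(1)[OF assms(15)] span_base[of x0 "{x0}"] by blast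
  obtain a L \<phi> \<phi>' \<psi> \<psi>' V
    where d\<phi>: "\<And>\<alpha>. \<bar>\<alpha>\<bar> < a \<Longrightarrow> (\<phi> has_vector_derivative \<phi>' \<alpha>) (at \<alpha>)" and c\<phi>': "continuous_on {-a<..<a} \<phi>'"
    and d\<psi>: "\<And>\<alpha>. \<bar>\<alpha>\<bar> < a \<Longrightarrow> (\<psi> has_vector_derivative \<psi>' \<alpha>) (at \<alpha>)" and c\<psi>': "continuous_on {-a<..<a} \<psi>'"
    and lip: "\<And>\<alpha>. \<bar>\<alpha>\<bar> < a \<Longrightarrow> \<bar>\<phi> \<alpha> - s_star\<bar> \<le> L * \<bar>\<alpha>\<bar>"
    and a: "a > 0" and \<phi>0: "\<phi> 0 = s_star" and \<psi>0: "\<psi> 0 = 0"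
    and zero: "\<And>\<alpha>. \<bar>\<alpha>\<bar> < a \<Longrightarrow> \<phi> \<alpha> \<in> I_m \<and> \<psi> \<alpha> \<in> Z \<and> F (\<phi> \<alpha>, b_m (\<phi> \<alpha>) + \<alpha> *\<^sub>R (x0 + \<psi> \<alpha>)) = 0"
    and V: "open V" "(s_star, b_m s_star) \<in> V" "V \<subseteq> I_m \<times> UNIV"
    and Vz: "\<And>s x. (s, x) \<in> V \<Longrightarrow> x \<in> W_d \<Longrightarrow> F (s, x) = 0 \<Longrightarrow>
       x = b_m s \<or> (\<exists>\<alpha>. \<bar>\<alpha>\<bar> < a \<and> s = \<phi> \<alpha> \<and> x = b_m s + \<alpha> *\<^sub>R (x0 + \<psi> \<alpha>))"
    by (rule local_bifurcation[OF I assms(2) Im(1,4,3) b bW Fb assms(8,9) b1 x0 a2 b2 assms(15,16)],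
        assumption, rule that, assumption+)
  \<comment> \<open>The resulting distance \<open>d\<close> from \<open>-x0\<close> to the closed
    set \<open>Z\<close> is used three times: the daughter branch meets the mother branch only at
    amplitude 0, its parametrization has nonzero derivative, and it satisfies the cone
    condition.\<close>
  have "- x0 \<notin> Z"
  proof
    assume "- x0 \<in> Z"
    then have "x0 \<in> Z" using subspace_neg[OF Zs(1)] by fastforce
    then show False using Zs(2) x0 span_base[of x0 "{x0}"] by blast
  qed
  then obtain d where d: "d > 0" "ball (- x0) d \<subseteq> - Z"
    using assms(16) openE[of "- Z" "- x0"] by (auto simp: open_Compl)
  have dZ: "d \<le> norm (x0 + z)" if "z \<in> Z" for z
  proof -
    have "d \<le> dist z (- x0)" using d(2) that by (force simp: dist_commute)
    then show ?thesis by (simp add: dist_norm add.commute)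
  qed
  define Cm where "Cm = mother_branch I_m b_m"
  define Cd where "Cd = daughter_branch b_m x0 a \<phi> \<psi>"
  define \<delta> where "\<delta> \<alpha> = (\<phi> \<alpha>, b_m (\<phi> \<alpha>) + \<alpha> *\<^sub>R (x0 + \<psi> \<alpha>))" for \<alpha>
  have Cm: "(s, x) \<in> Cm \<longleftrightarrow> s \<in> I_m \<and> x = b_m s" for s x
    by (auto simp: Cm_def mother_branch_def)
  have Cd: "p \<in> Cd \<longleftrightarrow> (\<exists>\<alpha>. \<bar>\<alpha>\<bar> < a \<and> p = \<delta> \<alpha>)" for p
    unfolding Cd_def daughter_branch_def \<delta>_def by (auto simp: scaleR_add_right add.assoc)
  have base: "(s_star, x_star) = \<delta> 0" using \<phi>0 bm(3) by (simp add: \<delta>_def)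
  have \<delta>m: "\<delta> \<alpha> \<in> Cm \<longleftrightarrow> \<alpha> = 0" if "\<bar>\<alpha>\<bar> < a" for \<alpha>
    using zero[OF that] dZ[of "\<psi> \<alpha>"] d(1) by (auto simp: \<delta>_def Cm)
  have Cd_zero: "F p = 0 \<and> p \<in> I \<times> W_d" if p: "p \<in> Cd" for p
  proof -
    obtain \<alpha> where \<alpha>: "\<bar>\<alpha>\<bar> < a" "p = \<delta> \<alpha>" using p by (auto simp: Cd)
    then show ?thesis
      using zero[OF \<alpha>(1)] Im(4) x0W ZW bW
      by (auto simp: \<delta>_def intro!: subspace_add[OF Wd] subspace_scale[OF Wd])
  qed
  have Cm_zero: "F p = 0 \<and> p \<in> I \<times> W_d" if "p \<in> Cm" for p
    using that Fb Im(4) bW by (cases p) (auto simp: Cm)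
  \<comment> \<open>\<open>U\<close> has to contain all of \<open>Cm\<close> and \<open>Cd\<close>, although zeros are controlled only inside \<open>V\<close>.\<close>
  define U where "U = V \<union> Cm \<union> Cd"
  have nbhd: "neighborhood_in (I \<times> UNIV) (s_star, x_star) U"
    unfolding neighborhood_in_def
  proof (intro conjI exI[of _ V])
    show "U \<subseteq> I \<times> UNIV" unfolding U_def using V(3) Im(4) Cm_zero Cd_zero by blast
    show "openin (top_of_set (I \<times> UNIV)) V" using V(1,3) Im(4) by (intro open_subset) auto
  qed (use V(2) bm(3) in \<open>auto simp: U_def\<close>)
  have zeros: "{p. F p = 0} \<inter> (I \<times> W_d) \<inter> U = Cm \<union> Cd"
  proof
    show "{p. F p = 0} \<inter> (I \<times> W_d) \<inter> U \<subseteq> Cm \<union> Cd"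
    proof
      fix p assume p: "p \<in> {p. F p = 0} \<inter> (I \<times> W_d) \<inter> U"
      obtain s x where sx: "p = (s, x)" by force
      show "p \<in> Cm \<union> Cd"
      proof (cases "p \<in> V")
        case True
        then have "x = b_m s \<or> (\<exists>\<alpha>. \<bar>\<alpha>\<bar> < a \<and> s = \<phi> \<alpha> \<and> x = b_m s + \<alpha> *\<^sub>R (x0 + \<psi> \<alpha>))"
          using p by (intro Vz) (auto simp: sx)
        moreover have "s \<in> I_m" using True V(3) sx by auto
        ultimately show ?thesis unfolding sx Un_iff Cm Cd \<delta>_def by blast
      qed (use p in \<open>auto simp: U_def\<close>)
    qed
    show "Cm \<union> Cd \<subseteq> {p. F p = 0} \<inter> (I \<times> W_d) \<inter> U"
      using Cm_zero Cd_zero by (auto simp: U_def)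
  qed
  have int: "Cm \<inter> Cd = {(s_star, x_star)}"
    using \<delta>m a unfolding base Cd set_eq_iff Int_iff singleton_iff by (metis abs_zero)
  obtain b' where b': "\<And>s. s \<in> I_m \<Longrightarrow> (b_m has_vector_derivative b' s) (at s)" "continuous_on I_m b'"
    using C1_on_imp_C1_differentiable_on[OF b] unfolding C1_differentiable_on_def by blast
  have Cm_branch: "solution_branch I F Cm"
    unfolding solution_branch_def simple_C1_curve_def
  proof (intro conjI exI)
    have D: "((\<lambda>s. (s, b_m s)) has_vector_derivative (1, b' s)) (at s)" if "s \<in> I_m" for s
      by (intro has_vector_derivative_Pair has_vector_derivative_id b' that)
    show "open_interval I_m" using Im by (simp add: open_interval_def)
    show "(\<lambda>s. (s, b_m s)) C1_differentiable_on I_m"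
      unfolding C1_differentiable_on_def
      using D b'(2) by (intro exI[of _ "\<lambda>s. (1, b' s)"] conjI ballI continuous_intros) auto
    show "\<forall>s\<in>I_m. vector_derivative (\<lambda>s. (s, b_m s)) (at s) \<noteq> 0"
      using vector_derivative_at[OF D] by (auto simp: prod_eq_iff)
    show "inj_on (\<lambda>s. (s, b_m s)) I_m" by (auto simp: inj_on_def)
    show "Cm = (\<lambda>s. (s, b_m s)) ` I_m" by (auto simp: Cm_def mother_branch_def)
    show "Cm \<subseteq> {p. F p = 0} \<inter> (I \<times> UNIV)" using Cm_zero by blast
  qed
  have c\<phi>: "continuous_on {-a<..<a} \<phi>" and c\<psi>: "continuous_on {-a<..<a} \<psi>"
    using has_vector_derivative_continuous[OF d\<phi>] has_vector_derivative_continuous[OF d\<psi>]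
    by (auto intro!: continuous_at_imp_continuous_on simp: abs_less_iff)
  have Cd_branch: "solution_branch I F Cd"
    unfolding solution_branch_def simple_C1_curve_def
  proof (intro conjI exI)
    define D where "D \<alpha> = (\<phi>' \<alpha>, \<phi>' \<alpha> *\<^sub>R b' (\<phi> \<alpha>) + (\<alpha> *\<^sub>R \<psi>' \<alpha> + (x0 + \<psi> \<alpha>)))" for \<alpha>
    have D: "(\<delta> has_vector_derivative D \<alpha>) (at \<alpha>)" if "\<bar>\<alpha>\<bar> < a" for \<alpha>
    proof -
      have 1: "((b_m \<circ> \<phi>) has_vector_derivative \<phi>' \<alpha> *\<^sub>R b' (\<phi> \<alpha>)) (at \<alpha>)"
        using zero[OF that] by (intro vector_diff_chain_at d\<phi> that b') auto
      have 2: "((\<lambda>\<alpha>. x0 + \<psi> \<alpha>) has_vector_derivative \<psi>' \<alpha>) (at \<alpha>)"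
        using has_vector_derivative_add[OF has_vector_derivative_const d\<psi>[OF that], of x0] by simp
      have 3: "((\<lambda>\<alpha>. \<alpha> *\<^sub>R (x0 + \<psi> \<alpha>)) has_vector_derivative (\<alpha> *\<^sub>R \<psi>' \<alpha> + 1 *\<^sub>R (x0 + \<psi> \<alpha>))) (at \<alpha>)"
        by (rule bounded_bilinear.has_vector_derivative[OF bounded_bilinear_scaleR has_vector_derivative_id 2])
      show ?thesis
        unfolding \<delta>_def D_def
        using has_vector_derivative_Pair[OF d\<phi>[OF that] has_vector_derivative_add[OF 1 3]] by (simp add: o_def)
    qed
    show "open_interval {-a<..<a}" using a by (auto simp: open_interval_def is_interval_oo)
    show "\<delta> C1_differentiable_on {-a<..<a}"
      unfolding C1_differentiable_on_def
    proof (intro exI[of _ D] conjI ballI)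
      show "continuous_on {-a<..<a} D"
        unfolding D_def using zero
        by (intro continuous_intros c\<phi>' c\<psi>' c\<psi> continuous_on_compose2[OF b'(2) c\<phi>]) (auto simp: abs_less_iff)
    qed (simp add: D abs_less_iff)
    show "inj_on \<delta> {-a<..<a}"
    proof (rule inj_onI)
      fix \<alpha> \<beta> assume "\<alpha> \<in> {-a<..<a}" "\<beta> \<in> {-a<..<a}" and eq: "\<delta> \<alpha> = \<delta> \<beta>"
      then have \<alpha>\<beta>: "\<psi> \<alpha> \<in> Z" "\<psi> \<beta> \<in> Z" using zero by (auto simp: abs_less_iff)
      have "\<alpha> *\<^sub>R (x0 + \<psi> \<alpha>) = \<beta> *\<^sub>R (x0 + \<psi> \<beta>)" using eq by (auto simp: \<delta>_def)
      then have "(\<alpha> - \<beta>) *\<^sub>R x0 = \<beta> *\<^sub>R \<psi> \<beta> - \<alpha> *\<^sub>R \<psi> \<alpha>" by (simp add: algebra_simps)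
      moreover have "\<beta> *\<^sub>R \<psi> \<beta> - \<alpha> *\<^sub>R \<psi> \<alpha> \<in> Z"
        by (intro subspace_diff subspace_scale Zs \<alpha>\<beta>)
      moreover have "(\<alpha> - \<beta>) *\<^sub>R x0 \<in> span {x0}" by (intro span_scale span_base) simp
      ultimately have "(\<alpha> - \<beta>) *\<^sub>R x0 \<in> span {x0} \<inter> Z" by (metis IntI)
      then have "(\<alpha> - \<beta>) *\<^sub>R x0 = 0" using Zs(2) by blast
      then show "\<alpha> = \<beta>" using x0 by simp
    qed
    show "\<forall>\<alpha>\<in>{-a<..<a}. vector_derivative \<delta> (at \<alpha>) \<noteq> 0"
    proof
      fix \<alpha> assume "\<alpha> \<in> {-a<..<a}"
      then have \<alpha>: "\<bar>\<alpha>\<bar> < a" by (simp add: abs_less_iff)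
      \<comment> \<open>If the first component of the velocity vanishes, the second is
        \<open>x0\<close> plus an element of \<open>Z\<close>, hence nonzero; closedness of
        \<open>Z\<close> puts the derivative of \<psi> there.\<close>
      have "\<psi>' \<alpha> \<in> Z"
        using zero
        by (intro vector_derivative_in_closed_subspace[OF d\<psi>[OF \<alpha>] Zs(1) assms(16), of "{-a<..<a}"])
           (use \<alpha> in \<open>auto simp: abs_less_iff\<close>)
      then have "\<psi> \<alpha> + \<alpha> *\<^sub>R \<psi>' \<alpha> \<in> Z"
        using zero[OF \<alpha>] by (intro subspace_add subspace_scale Zs) auto
      from dZ[OF this] d(1) have "\<alpha> *\<^sub>R \<psi>' \<alpha> + (x0 + \<psi> \<alpha>) \<noteq> 0" by (auto simp: algebra_simps)
      then show "vector_derivative \<delta> (at \<alpha>) \<noteq> 0"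
        unfolding vector_derivative_at[OF D[OF \<alpha>]] by (auto simp: D_def prod_eq_iff)
    qed
    show "Cd = \<delta> ` {-a<..<a}" by (force simp: Cd abs_less_iff)
    show "Cd \<subseteq> {p. F p = 0} \<inter> (I \<times> UNIV)" using Cd_zero by blast
  qed
  \<comment> \<open>Subarcs of a branch are again branches, so "exactly two" is expressed as
    containment of every competing branch in one of the two.\<close>
  have exactly: "B \<subseteq> Cm \<or> B \<subseteq> Cd"
    if B: "solution_branch I F B" "B \<subseteq> (I \<times> W_d) \<inter> U" "(s_star, x_star) \<in> B" for B
  proof -
    obtain T \<gamma> where T: "open_interval T" and \<gamma>: "\<gamma> C1_differentiable_on T" "inj_on \<gamma> T"
      "\<And>t. t \<in> T \<Longrightarrow> vector_derivative \<gamma> (at t) \<noteq> 0" and BT: "B = \<gamma> ` T"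
      using B(1) unfolding solution_branch_def simple_C1_curve_def by blast
    obtain \<gamma>' where \<gamma>': "\<And>t. t \<in> T \<Longrightarrow> (\<gamma> has_vector_derivative \<gamma>' t) (at t)"
      using \<gamma>(1) unfolding C1_differentiable_on_def by blast
    obtain t0 where t0: "t0 \<in> T" "\<gamma> t0 = (s_star, x_star)" using B(3) BT by auto
    have "B \<subseteq> {p. F p = 0}" using B(1) by (auto simp: solution_branch_def)
    then have cover: "\<gamma> t \<in> Cm \<union> Cd" if "t \<in> T" for t
      using B(2) that unfolding zeros[symmetric] BT by blast
    have fst_Im: "fst (\<gamma> t) \<in> I_m" if "t \<in> T" for t
      using cover[OF that] zero by (cases "\<gamma> t") (auto simp: Cm Cd \<delta>_def abs_less_iff)
    have mem: "\<gamma> t \<in> Cm \<longleftrightarrow> snd (\<gamma> t) = b_m (fst (\<gamma> t))" if "t \<in> T" for t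
      using fst_Im[OF that] by (cases "\<gamma> t") (auto simp: Cm)
    \<comment> \<open>At amplitude \<alpha> the parameter has moved by at most \<bar>L\<bar> times
      \<bar>\<alpha>\<bar>, while the distance from the mother branch at the same parameter is at
      least \<open>d\<close> times \<bar>\<alpha>\<bar>. The absolute value of \<open>L\<close> is
      taken because its sign is not recorded.\<close>
    have cone: "\<bar>fst (\<gamma> t) - s_star\<bar> \<le> \<bar>L\<bar> / d * norm (snd (\<gamma> t) - b_m (fst (\<gamma> t)))"
      if t: "t \<in> T" "snd (\<gamma> t) \<noteq> b_m (fst (\<gamma> t))" for t
    proof -
      have "\<gamma> t \<in> Cd" using cover[OF t(1)] mem[OF t(1)] t(2) by blast
      then obtain \<alpha> where \<alpha>: "\<bar>\<alpha>\<bar> < a" "\<gamma> t = \<delta> \<alpha>" by (auto simp: Cd)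
      have "\<bar>fst (\<gamma> t) - s_star\<bar> \<le> L * \<bar>\<alpha>\<bar>" using lip[OF \<alpha>(1)] \<alpha>(2) by (simp add: \<delta>_def)
      also have "\<dots> \<le> \<bar>L\<bar> * \<bar>\<alpha>\<bar>" by (intro mult_right_mono) auto
      also have "\<dots> = \<bar>L\<bar> / d * (\<bar>\<alpha>\<bar> * d)" using d(1) by simp
      also have "\<dots> \<le> \<bar>L\<bar> / d * (\<bar>\<alpha>\<bar> * norm (x0 + \<psi> \<alpha>))"
        using dZ[of "\<psi> \<alpha>"] zero[OF \<alpha>(1)] d(1) by (intro mult_left_mono) auto
      also have "\<bar>\<alpha>\<bar> * norm (x0 + \<psi> \<alpha>) = norm (snd (\<gamma> t) - b_m (fst (\<gamma> t)))"
        by (simp add: \<alpha>(2) \<delta>_def)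
      finally show ?thesis .
    qed
    have "(\<forall>t\<in>T. snd (\<gamma> t) = b_m (fst (\<gamma> t))) \<or> (\<forall>t\<in>T - {t0}. snd (\<gamma> t) \<noteq> b_m (fst (\<gamma> t)))"
    proof (rule curve_through_crossing[where S = I_m and c = "\<bar>L\<bar> / d"])
      show "open T" "connected T" using T by (auto simp: open_interval_def is_interval_connected)
      show "\<gamma>' t0 \<noteq> 0" using \<gamma>(3)[OF t0(1)] vector_derivative_at[OF \<gamma>'[OF t0(1)]] by simp
      show "continuous_on I_m b_m" by (rule C1_on_continuous_on[OF b])
      show "(b_m has_vector_derivative b' s_star) (at s_star)" by (rule b'(1)[OF Im(3)])
      show "\<bar>L\<bar> / d \<ge> 0" using d(1) by simp
      show "\<gamma> t0 = (s_star, b_m s_star)" using t0(2) bm(3) by simp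
    qed (use t0 \<gamma>(2) \<gamma>' fst_Im cone in auto)
    then show ?thesis
    proof
      assume "\<forall>t\<in>T. snd (\<gamma> t) = b_m (fst (\<gamma> t))"
      then have "B \<subseteq> Cm" using mem BT by blast
      then show ?thesis ..
    next
      assume *: "\<forall>t\<in>T - {t0}. snd (\<gamma> t) \<noteq> b_m (fst (\<gamma> t))"
      have "\<gamma> t \<in> Cd" if "t \<in> T" for t
      proof (cases "t = t0")
        case True
        then show ?thesis using t0(2) int by blast
      next
        case False
        then show ?thesis using that * mem[OF that] cover[OF that] by blast
      qed
      then have "B \<subseteq> Cd" using BT by blast
      then show ?thesis ..
    qed
  qed
  show ?thesis
  proof (rule exI[of _ U], rule exI[of _ a], rule exI[of _ \<phi>], rule exI[of _ \<psi>], unfold Let_def, fold Cm_def Cd_def, intro conjI)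
    show "neighborhood_in (I \<times> UNIV) (s_star, x_star) U" by (rule nbhd)
    show "0 < a" by (rule a)
    show "\<phi> C1_differentiable_on {-a<..<a}"
      unfolding C1_differentiable_on_def
      using d\<phi> c\<phi>' by (intro exI[of _ \<phi>'] conjI ballI) (auto simp: abs_less_iff)
    show "\<psi> C1_differentiable_on {-a<..<a}"
      unfolding C1_differentiable_on_def
      using d\<psi> c\<psi>' by (intro exI[of _ \<psi>'] conjI ballI) (auto simp: abs_less_iff)
    show "\<phi> ` {-a<..<a} \<subseteq> I_m" "\<psi> ` {-a<..<a} \<subseteq> Z"
      using zero by (auto simp: abs_less_iff)
    show "\<phi> 0 = s_star" "\<psi> 0 = 0" by fact+
    show "{p. F p = 0} \<inter> (I \<times> W_d) \<inter> U = Cm \<union> Cd" by (rule zeros)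
    show "Cm \<inter> Cd = {(s_star, x_star)}" by (rule int)
    show "solution_branch I F Cm" by (rule Cm_branch)
    show "solution_branch I F Cd" by (rule Cd_branch)
    show "\<forall>B. solution_branch I F B \<and> B \<subseteq> (I \<times> W_d) \<inter> U \<and> (s_star, x_star) \<in> B
              \<longrightarrow> B \<subseteq> Cm \<or> B \<subseteq> Cd"
      using exactly by blast
  qed
qed

end
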